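(* Let $\omega:\mathbb R\to(0,+\infty)$ be a positive, measurable, essentially bounded function with $\mathcal L(\omega)>-\infty$, and assume that there exist $\alpha\in(0,1)$ and $K_0>0$ such that $|\log\omega(x)-\log\omega(y)|\leq K_0|x-y|^\alpha$ for all $x,y\in\mathbb R$. Set $\Omega=-\log\omega$ and let $\sigma'>0$. Then, for $$t=\left(\frac{K_0}{\pi\sigma'\cos\left(\frac{\pi\alpha}{2}\right)}\right)^{\frac{1}{1-\alpha}},$$ we have, for all $x\in\mathbb R$, $$|P_t\Omega(x)-\Omega(x)|\leq\left(\frac{K_0}{\cos\left(\frac{\pi\alpha}{2}\right)}\right)^{\frac{1}{1-\alpha}}\left(\frac{1}{\pi\sigma'}\right)^{\frac{\alpha}{1-\alpha}},$$ and $$\|(H(P_t\Omega))'\|_{L^\infty}\leq\pi\sigma' .$$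
   Context: For a positive bounded measurable function $\omega$ on $\mathbb R$, the logarithmic integral is $\mathcal L(\omega)=\int_{\mathbb R}\frac{\log\omega(x)}{1+x^2}\,dx\in[-\infty,+\infty)$. Write $\langle x\rangle=\sqrt{1+x^2}$. For $f\in L^1(\mathbb R,\langle x\rangle^{-2}dx)$ and $t>0$, the Poisson transform is $$P_tf(x)=\int_{\mathbb R}\frac{t\,f(y)}{\pi(t^2+(x-y)^2)}\,dy,$$ and the modified Hilbert transform is $$H(f)(x)=\frac1\pi\,\mathrm{p.v.}\int_{\mathbb R}f(y)\left(\frac{1}{x-y}+\frac{y}{y^2+1}\right)dy .$$ *)

theory Defs
  imports "HOL-Probability.Essential_Supremum"
begin

definition japanese_bracket :: "real \<Rightarrow> real" where
  "japanese_bracket x = sqrt (1 + x\<^sup>2)"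

definition L1_weighted :: "(real \<Rightarrow> real) \<Rightarrow> bool" where
  "L1_weighted f \<longleftrightarrow> integrable lebesgue (\<lambda>x. f x * japanese_bracket x powr (-2))"

text \<open>The value of \<^term>\<open>esssup\<close> at a non-measurable function is \<open>\<infinity>\<close>, so a finite norm entails
  Lebesgue measurability of \<open>|f|\<close>.\<close>

definition Linf_norm :: "(real \<Rightarrow> real) \<Rightarrow> ereal" where
  "Linf_norm f = esssup lebesgue (\<lambda>x. ereal \<bar>f x\<bar>)"

text \<open>Integral of the positive part minus integral of the negative part. For bounded \<open>\<omega>\<close> the first
  term is finite, so the ambiguous difference \<open>\<infinity> - \<infinity>\<close> does not arise and the value lies in
  \<open>[-\<infinity>, \<infinity>)\<close>.\<close>

definition log_integral :: "(real \<Rightarrow> real) \<Rightarrow> ereal" where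
  "log_integral \<omega> =
     enn2ereal (\<integral>\<^sup>+x. ennreal (max 0 (ln (\<omega> x) / (1 + x\<^sup>2))) \<partial>lebesgue)
   - enn2ereal (\<integral>\<^sup>+x. ennreal (max 0 (- (ln (\<omega> x) / (1 + x\<^sup>2)))) \<partial>lebesgue)"

definition poisson :: "real \<Rightarrow> (real \<Rightarrow> real) \<Rightarrow> real \<Rightarrow> real" where
  "poisson t f x = (LINT y|lebesgue. t * f y / (pi * (t\<^sup>2 + (x - y)\<^sup>2)))"

text \<open>Principal value at the only singularity \<open>x\<close>. No truncation at infinity is used: outside any
  neighbourhood of \<open>x\<close> the integrand is required to be absolutely integrable.\<close>

definition has_pv_integral :: "(real \<Rightarrow> real) \<Rightarrow> real \<Rightarrow> real \<Rightarrow> bool" where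
  "has_pv_integral g x l \<longleftrightarrow>
     (\<forall>\<epsilon>>0. set_integrable lebesgue {y. \<bar>x - y\<bar> > \<epsilon>} g) \<and>
     ((\<lambda>\<epsilon>. set_lebesgue_integral lebesgue {y. \<bar>x - y\<bar> > \<epsilon>} g) \<longlongrightarrow> l) (at_right 0)"

definition pv_integral :: "(real \<Rightarrow> real) \<Rightarrow> real \<Rightarrow> real" where
  "pv_integral g x = (THE l. has_pv_integral g x l)"

text \<open>At \<open>|y| \<rightarrow> \<infinity>\<close> the two terms cancel to order \<open>y\<^sup>-\<^sup>2\<close>, so for \<open>f\<close> in the weighted space
  \<^const>\<open>L1_weighted\<close> the integrability requirement of \<^const>\<open>has_pv_integral\<close> holds.\<close>

definition hilbert_integrand :: "(real \<Rightarrow> real) \<Rightarrow> real \<Rightarrow> real \<Rightarrow> real" where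
  "hilbert_integrand f x y = f y * (1 / (x - y) + y / (y\<^sup>2 + 1))"

definition hilbert :: "(real \<Rightarrow> real) \<Rightarrow> real \<Rightarrow> real" where
  "hilbert f x = 1 / pi * pv_integral (hilbert_integrand f x) x"

end

theory Submission
  imports Defs "HOL-Real_Asymp.Real_Asymp"
begin

text \<open>
  Write \<open>p\<^sub>t(s) = t / (\<pi> (t\<^sup>2 + s\<^sup>2))\<close> for the Poisson kernel and \<open>q\<^sub>t(s) = s / (t\<^sup>2 + s\<^sup>2)\<close> for \<open>\<pi>\<close> times
  its conjugate. Both bounds are one estimate. If \<open>\<bar>k(s)\<bar> \<le> 1 / (t\<^sup>2 + s\<^sup>2)\<close>, then replacing \<open>\<Omega>(y)\<close> by
  \<open>\<Omega>(y) - \<Omega>(x)\<close> in \<open>\<integral> \<Omega>(y) k(x - y) dy\<close> removes exactly \<open>\<Omega>(x) \<integral> k\<close>, and the Hoelder condition bounds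
  what is left by
  \<open>K\<^sub>0 \<integral> \<bar>s\<bar>\<^sup>\<alpha> / (t\<^sup>2 + s\<^sup>2) ds = \<pi> K\<^sub>0 t\<^bsup>\<alpha> - 1\<^esup> / cos (\<pi>\<alpha>/2)\<close> (\<open>abs_integral_minus_mean_le\<close>).
  The value of the integral is Euler's reflection formula for the Beta function
  (\<open>has_integral_powr_cauchy\<close>); it is where the cosine comes from.

  With \<open>k = p\<^sub>t \<pi> / t\<close>, of integral \<open>\<pi> / t\<close>, this gives
  \<open>\<bar>P\<^sub>t\<Omega> - \<Omega>\<bar> \<le> K\<^sub>0 t\<^sup>\<alpha> / cos (\<pi>\<alpha>/2)\<close>. With \<open>k = q\<^sub>t'\<close>, of integral \<open>0\<close>, it gives
  \<open>\<bar>(H(P\<^sub>t\<Omega>))'\<bar> \<le> K\<^sub>0 t\<^bsup>\<alpha> - 1\<^esup> / cos (\<pi>\<alpha>/2)\<close>, once \<open>(H(P\<^sub>t\<Omega>))' = \<pi>\<^sup>-\<^sup>1 \<Omega> * q\<^sub>t'\<close> is known. The given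
  \<open>t\<close> is the solution of \<open>K\<^sub>0 t\<^bsup>\<alpha> - 1\<^esup> / cos (\<pi>\<alpha>/2) = \<pi>\<sigma>'\<close>.

  The rest of the work is the formula for the derivative. It comes from
  \<open>\<pi> H(P\<^sub>t\<Omega>)(x) = \<integral> \<Omega>(y) (q\<^sub>t(x - y) + c(y)) dy\<close>, where \<open>c\<close>, the Poisson transform of \<open>u / (u\<^sup>2 + 1)\<close>, does not
  depend on \<open>x\<close> and makes the integral converge. To see this, truncate the singular kernel of \<open>H\<close> to \<open>\<bar>x - u\<bar> > \<epsilon>\<close> and
  exchange the order of integration (\<open>fubini_truncated_hilbert_poisson\<close>); the inner integral is then a
  truncated modified Hilbert transform of the Poisson kernel. For its singular part, adding its integrand at \<open>s\<close> and \<open>-s\<close> cancels the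
  singularity and leaves a rational function with an elementary antiderivative
  (\<open>has_integral_folded_kernel\<close>), so the inner integral differs from its limit \<open>q\<^sub>t(x - y) + c(y)\<close> by at most
  a constant times \<open>\<epsilon> / (t\<^sup>2 + (x - y)\<^sup>2)\<close>. This is integrable against \<open>\<Omega>\<close>, which grows at most like
  \<open>\<bar>y\<bar>\<^sup>\<alpha>\<close> with \<open>\<alpha> < 1\<close>, and the limit \<open>\<epsilon> \<rightarrow> 0\<close> follows (\<open>has_pv_integral_hilbert_poisson\<close>).
  Differentiation under the integral sign rests on a second-order Taylor bound for \<open>q\<^sub>t\<close> of the same
  shape (\<open>conj_kernel_taylor\<close>).
\<close>

section \<open>Power moments of the Cauchy kernel\<close>

text \<open>The integrand of the Beta function with parameters \<open>(1 \<plusminus> \<alpha>) / 2\<close>, pulled back along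
  \<open>v = s\<^sup>2 / (1 + s\<^sup>2)\<close>. This map takes the half-line to the unit interval.\<close>

lemma beta_integrand_substitution:
  fixes \<alpha> s :: real
  assumes "s > 0"
  shows "\<bar>2 * s / (1 + s\<^sup>2)\<^sup>2\<bar> *
      ((s\<^sup>2 / (1 + s\<^sup>2)) powr ((1 + \<alpha>) / 2 - 1) * (1 - s\<^sup>2 / (1 + s\<^sup>2)) powr ((1 - \<alpha>) / 2 - 1))
    = 2 * (s powr \<alpha> / (1 + s\<^sup>2))"
proof -
  define w where "w = 1 + s\<^sup>2"
  have w: "w > 0" by (simp add: w_def add_pos_nonneg)
  have c: "1 - s\<^sup>2 / w = 1 / w" using w by (simp add: field_simps w_def)
  have sq: "s\<^sup>2 = s powr 2" using assms by (simp add: powr_numeral)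
  have "(s\<^sup>2 / w) powr ((1 + \<alpha>) / 2 - 1) = s powr (\<alpha> - 1) * w powr ((1 - \<alpha>) / 2)"
  proof -
    have "(s\<^sup>2 / w) powr ((1 + \<alpha>) / 2 - 1) = (s\<^sup>2) powr ((1 + \<alpha>) / 2 - 1) / w powr ((1 + \<alpha>) / 2 - 1)"
      using w by (simp add: powr_divide)
    also have "(s\<^sup>2) powr ((1 + \<alpha>) / 2 - 1) = s powr (\<alpha> - 1)"
      unfolding sq powr_powr by (rule arg_cong[where f="\<lambda>e. s powr e"]) (simp add: field_simps)
    also have "s powr (\<alpha> - 1) / w powr ((1 + \<alpha>) / 2 - 1) = s powr (\<alpha> - 1) * w powr (- ((1 + \<alpha>) / 2 - 1))"
      by (simp only: powr_minus_divide) simp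
    also have "- ((1 + \<alpha>) / 2 - 1) = (1 - \<alpha>) / 2" by (simp add: field_simps)
    finally show ?thesis .
  qed
  moreover have "(1 / w) powr ((1 - \<alpha>) / 2 - 1) = w powr ((1 + \<alpha>) / 2)"
  proof -
    have "(1 / w) powr ((1 - \<alpha>) / 2 - 1) = w powr (- ((1 - \<alpha>) / 2 - 1))"
      using w by (simp only: powr_minus_divide) (simp add: powr_divide)
    also have "- ((1 - \<alpha>) / 2 - 1) = (1 + \<alpha>) / 2" by (simp add: field_simps)
    finally show ?thesis .
  qed
  moreover have "w powr ((1 - \<alpha>) / 2) * w powr ((1 + \<alpha>) / 2) = w"
    using w by (simp add: powr_add[symmetric] field_simps)
  moreover have "s * s powr (\<alpha> - 1) = s powr \<alpha>"
    using assms by (simp add: powr_mult_base)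
  ultimately show ?thesis
    using w assms unfolding w_def[symmetric] c
    by (simp add: power2_eq_square field_simps)
qed

text \<open>With \<open>a = (1 + \<alpha>) / 2\<close> the integral is \<open>\<Gamma>(a) \<Gamma>(1 - a) / 2 = \<pi> / (2 sin (\<pi> a))\<close>, by
  Euler's reflection formula, and \<open>sin (\<pi> a) = cos (\<pi>\<alpha>/2)\<close>.\<close>

lemma has_integral_powr_cauchy_half_line:
  fixes \<alpha> :: real
  assumes "\<bar>\<alpha>\<bar> < 1"
  shows "has_bochner_integral lborel (\<lambda>s. indicator {0<..} s * (s powr \<alpha> / (1 + s\<^sup>2)))
           (pi / (2 * cos (pi * \<alpha> / 2)))"
proof -
  define a b where "a = (1 + \<alpha>) / 2" and "b = (1 - \<alpha>) / 2"
  have ab: "a > 0" "b > 0" "a + b = 1" using assms by (auto simp: a_def b_def field_simps)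
  define B where "B = (\<lambda>v::real. v powr (a - 1) * (1 - v) powr (b - 1))"
  define g where "g = (\<lambda>s::real. s\<^sup>2 / (1 + s\<^sup>2))"
  have pos: "1 + s\<^sup>2 > 0" for s :: real by (simp add: add_pos_nonneg)
  have g_eq: "g s = 1 - 1 / (1 + s\<^sup>2)" for s
    using pos[of s] by (simp add: g_def field_simps)
  have inj: "inj_on g {0<..}"
  proof (rule inj_onI)
    fix x y :: real assume "x \<in> {0<..}" "y \<in> {0<..}" "g x = g y"
    then have "1 + x\<^sup>2 = 1 + y\<^sup>2" using pos[of x] pos[of y] by (simp add: g_eq)
    then show "x = y" using \<open>x \<in> {0<..}\<close> \<open>y \<in> {0<..}\<close> by (simp add: power2_eq_iff_nonneg)
  qed
  have img: "g ` {0<..} = {0<..<1}"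
  proof (intro equalityI subsetI)
    fix v assume "v \<in> g ` {0<..}"
    then show "v \<in> {0<..<1}" using pos by (auto simp: g_def)
  next
    fix v :: real assume v: "v \<in> {0<..<1}"
    have "g (sqrt (v / (1 - v))) = v"
      using v by (simp add: g_def) (simp add: field_simps)
    moreover have "sqrt (v / (1 - v)) \<in> {0<..}" using v by simp
    ultimately show "v \<in> g ` {0<..}" by (metis image_eqI)
  qed
  have der: "(g has_field_derivative 2 * s / (1 + s\<^sup>2)\<^sup>2) (at s within {0<..})" if "s \<in> {0<..}" for s
    unfolding g_def using pos[of s]
    by (auto intro!: derivative_eq_intros simp: power2_eq_square field_simps)
  have "(B has_integral Beta a b) {0<..<1}"
    using has_integral_Beta_real[OF ab(1,2)] unfolding B_def
    by (simp add: has_integral_Icc_iff_Ioo)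
  moreover have nn: "B v \<ge> 0" for v by (simp add: B_def)
  ultimately have "B absolutely_integrable_on g ` {0<..} \<and> integral (g ` {0<..}) B = Beta a b"
    unfolding img by (auto intro!: nonnegative_absolutely_integrable_1 simp: has_integral_iff)
  then have *: "(\<lambda>s. \<bar>2 * s / (1 + s\<^sup>2)\<^sup>2\<bar> * B (g s)) absolutely_integrable_on {0<..} \<and>
      integral {0<..} (\<lambda>s. \<bar>2 * s / (1 + s\<^sup>2)\<^sup>2\<bar> * B (g s)) = Beta a b"
    using has_absolute_integral_change_of_variables_1'[of "{0<..}" g "\<lambda>s. 2 * s / (1 + s\<^sup>2)\<^sup>2" B "Beta a b"]
      der inj by auto
  have eq: "indicator {0<..} s * (\<bar>2 * s / (1 + s\<^sup>2)\<^sup>2\<bar> * B (g s))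
      = 2 * (indicator {0<..} s * (s powr \<alpha> / (1 + s\<^sup>2)))" for s
    using beta_integrand_substitution[of s \<alpha>] by (simp add: B_def g_def a_def b_def indicator_def)
  have "integrable lebesgue (\<lambda>s. 2 * (indicator {0<..} s * (s powr \<alpha> / (1 + s\<^sup>2))))"
    using conjunct1[OF *] unfolding set_integrable_def real_scaleR_def eq .
  moreover have "integral\<^sup>L lebesgue (\<lambda>s. 2 * (indicator {0<..} s * (s powr \<alpha> / (1 + s\<^sup>2)))) = Beta a b"
  proof -
    have "set_lebesgue_integral lebesgue {0<..} (\<lambda>s. \<bar>2 * s / (1 + s\<^sup>2)\<^sup>2\<bar> * B (g s)) = Beta a b"
      using set_lebesgue_integral_eq_integral(2)[OF conjunct1[OF *]] * by simp
    then show ?thesis unfolding set_lebesgue_integral_def real_scaleR_def eq .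
  qed
  moreover have "Beta a b = pi / cos (pi * \<alpha> / 2)"
  proof -
    have "Beta a b = Gamma a * Gamma (1 - a)"
    proof -
      have b: "b = 1 - a" using ab by simp
      show ?thesis unfolding b by (simp add: Beta_def)
    qed
    also have "\<dots> = pi / sin (pi * a)"
    proof -
      have "complex_of_real (Gamma a * Gamma (1 - a)) = of_real (pi / sin (pi * a))"
        using Gamma_reflection_complex[of "complex_of_real a"]
        by (simp flip: Gamma_complex_of_real sin_of_real)
      then show ?thesis by (simp only: of_real_eq_iff)
    qed
    also have "sin (pi * a) = cos (pi * \<alpha> / 2)"
    proof -
      have "pi * a = pi / 2 + pi * \<alpha> / 2" by (simp add: a_def field_simps)
      then show ?thesis by (simp only: sin_add) simp
    qed
    finally show ?thesis .
  qed
  ultimately have "has_bochner_integral lborel (\<lambda>s. 2 * (indicator {0<..} s * (s powr \<alpha> / (1 + s\<^sup>2)))) (pi / cos (pi * \<alpha> / 2))"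
    by (simp add: has_bochner_integral_iff integrable_completion integral_completion)
  from has_bochner_integral_mult_right[OF this, of "1/2"] show ?thesis
    by simp
qed

lemma has_integral_powr_cauchy:
  fixes \<alpha> t :: real
  assumes "\<bar>\<alpha>\<bar> < 1" "t > 0"
  shows "has_bochner_integral lborel (\<lambda>s. \<bar>s\<bar> powr \<alpha> / (t\<^sup>2 + s\<^sup>2))
           (pi * t powr (\<alpha> - 1) / cos (pi * \<alpha> / 2))"
proof -
  have "has_bochner_integral lborel (\<lambda>s. indicator {0..} s *\<^sub>R (\<bar>s\<bar> powr \<alpha> / (1 + s\<^sup>2)))
           (pi / (2 * cos (pi * \<alpha> / 2)))"
    using has_integral_powr_cauchy_half_line[OF assms(1)]
    by (rule has_bochner_integral_cong[THEN iffD1, rotated -1]) (auto simp: indicator_def)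
  from has_bochner_integral_even_function[OF this]
  have unit: "has_bochner_integral lborel (\<lambda>s. \<bar>s\<bar> powr \<alpha> / (1 + s\<^sup>2)) (pi / cos (pi * \<alpha> / 2))"
    by simp
  have "has_bochner_integral lborel (\<lambda>s. \<bar>0 + (1/t) * s\<bar> powr \<alpha> / (1 + (0 + (1/t) * s)\<^sup>2)) ((pi / cos (pi * \<alpha> / 2)) /\<^sub>R \<bar>1/t\<bar>)"
    using lborel_has_bochner_integral_real_affine_iff[of "1/t" "\<lambda>s. \<bar>s\<bar> powr \<alpha> / (1 + s\<^sup>2)" _ 0] unit assms(2) by auto
  from has_bochner_integral_mult_right[OF this, of "t powr (\<alpha> - 2)"]
  have "has_bochner_integral lborel (\<lambda>s. t powr (\<alpha> - 2) * (\<bar>s / t\<bar> powr \<alpha> / (1 + (s / t)\<^sup>2)))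
      (t powr (\<alpha> - 2) * (pi / cos (pi * \<alpha> / 2) * t))"
    using assms(2) by (simp add: mult.commute)
  moreover have "\<And>s. t powr (\<alpha> - 2) * (\<bar>s / t\<bar> powr \<alpha> / (1 + (s / t)\<^sup>2)) = \<bar>s\<bar> powr \<alpha> / (t\<^sup>2 + s\<^sup>2)"
  proof -
    fix s
    have "1 + (s / t)\<^sup>2 = (t\<^sup>2 + s\<^sup>2) / t\<^sup>2"
      using assms(2) by (simp add: power_divide field_simps)
    moreover have "t powr (\<alpha> - 2) = t powr \<alpha> / t\<^sup>2"
      using assms(2) by (simp add: powr_diff powr_numeral)
    moreover have "\<bar>s / t\<bar> powr \<alpha> = \<bar>s\<bar> powr \<alpha> / t powr \<alpha>"
      using assms(2) by (simp add: powr_divide)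
    ultimately show "t powr (\<alpha> - 2) * (\<bar>s / t\<bar> powr \<alpha> / (1 + (s / t)\<^sup>2)) = \<bar>s\<bar> powr \<alpha> / (t\<^sup>2 + s\<^sup>2)" using assms(2) by simp
  qed
  moreover have "t powr (\<alpha> - 2) * (pi / cos (pi * \<alpha> / 2) * t) = pi * t powr (\<alpha> - 1) / cos (pi * \<alpha> / 2)"
  proof -
    have "t powr (\<alpha> - 1) = t * t powr (\<alpha> - 2)" using assms(2) by (simp add: powr_mult_base)
    then show ?thesis by simp
  qed
  ultimately show ?thesis by (simp only:)
qed

section \<open>The truncated Hilbert transform of the Poisson kernel\<close>

definition poisson_kernel :: "real \<Rightarrow> real \<Rightarrow> real" where
  "poisson_kernel t s = t / (pi * (t\<^sup>2 + s\<^sup>2))"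

text \<open>This is \<open>\<pi>\<close> times the conjugate Poisson kernel.\<close>

definition conj_kernel :: "real \<Rightarrow> real \<Rightarrow> real" where
  "conj_kernel t s = s / (t\<^sup>2 + s\<^sup>2)"

lemma sum_sq_pos: "t > 0 \<Longrightarrow> t\<^sup>2 + s\<^sup>2 > 0" for t s :: real
  by (simp add: add_pos_nonneg)

lemma has_integral_reflect_translate:
  fixes f :: "real \<Rightarrow> real"
  assumes "has_bochner_integral lborel f I"
  shows "has_bochner_integral lborel (\<lambda>y. f (x - y)) I"
  using lborel_has_bochner_integral_real_affine_iff[of "-1" f I x] assms by simp

lemma integral_reflect_translate:
  fixes f :: "real \<Rightarrow> real"
  shows "(LBINT y. f (x - y)) = (LBINT y. f y)"
  using lborel_integral_real_affine[of "-1" f x] by simp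

lemma integrable_reflect_translate:
  fixes f :: "real \<Rightarrow> real"
  shows "integrable lborel (\<lambda>y. f (x - y)) \<longleftrightarrow> integrable lborel f"
  using lborel_integrable_real_affine_iff[of "-1" f x] by simp

lemma has_integral_cauchy:
  assumes "t > 0"
  shows "has_bochner_integral lborel (\<lambda>s. 1 / (t\<^sup>2 + s\<^sup>2)) (pi / t)"
proof -
  have "has_bochner_integral lborel (\<lambda>s. \<bar>s\<bar> powr 0 / (t\<^sup>2 + s\<^sup>2)) (pi / t)"
    using has_integral_powr_cauchy[of 0 t] assms by (simp add: powr_minus_divide)
  \<comment> \<open>Only almost everywhere, because \<open>0 powr 0 = 0\<close>.\<close>
  moreover have "AE s in lborel. \<bar>s\<bar> powr 0 / (t\<^sup>2 + s\<^sup>2) = 1 / (t\<^sup>2 + s\<^sup>2)"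
    using AE_lborel_singleton[of 0] by eventually_elim simp
  ultimately show ?thesis
    by (subst (asm) has_bochner_integral_cong_AE) auto
qed

lemma poisson_kernel_measurable [measurable]: "poisson_kernel t \<in> borel_measurable borel"
  unfolding poisson_kernel_def by measurable

lemma conj_kernel_measurable [measurable]: "conj_kernel t \<in> borel_measurable borel"
  unfolding conj_kernel_def by measurable

lemma poisson_kernel_nonneg: "t > 0 \<Longrightarrow> poisson_kernel t s \<ge> 0"
  by (simp add: poisson_kernel_def)

lemma poisson_kernel_minus: "poisson_kernel t (- s) = poisson_kernel t s"
  by (simp add: poisson_kernel_def)

lemma has_integral_poisson_kernel:
  assumes "t > 0"
  shows "has_bochner_integral lborel (\<lambda>y. poisson_kernel t (x - y)) 1"
  using has_integral_reflect_translate[OF has_bochner_integral_mult_right[OF has_integral_cauchy[OF assms], of "t / pi"], of x] assms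
  by (simp add: poisson_kernel_def)

text \<open>Moving the centre by at most \<open>t\<close> changes the Cauchy kernel by a factor of at most \<open>3\<close>. It
  makes the error of a truncation at \<open>\<epsilon> \<le> t\<close> at most a multiple of \<open>\<epsilon> / (t\<^sup>2 + (x - y)\<^sup>2)\<close>, uniformly
  in \<open>y\<close>.\<close>

lemma cauchy_kernel_shift:
  fixes t b h :: real
  assumes "t > 0" "\<bar>h\<bar> \<le> t"
  shows "t\<^sup>2 + b\<^sup>2 \<le> 3 * (t\<^sup>2 + (b - h)\<^sup>2)"
proof -
  have "h\<^sup>2 \<le> t\<^sup>2" using assms by (simp add: abs_le_square_iff[symmetric])
  moreover have "0 \<le> (b - 2 * h)\<^sup>2" by simp
  then have "b\<^sup>2 \<le> 2 * (b - h)\<^sup>2 + 2 * h\<^sup>2" by (simp add: power2_eq_square algebra_simps)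
  moreover have "0 \<le> (b - h)\<^sup>2" by simp
  ultimately show ?thesis by argo
qed

lemma integral_FTC_line:
  fixes F f :: "real \<Rightarrow> real"
  assumes F: "\<And>x. (F has_real_derivative f x) (at x)"
    and f: "\<And>x. isCont f x" "integrable lborel f"
    and A: "(F \<longlongrightarrow> A) at_bot" and B: "(F \<longlongrightarrow> B) at_top"
  shows "(LBINT x. f x) = B - A"
proof -
  have "(LBINT x=-\<infinity>..\<infinity>. f x) = B - A"
  proof (rule interval_integral_FTC_integrable)
    show "(F has_vector_derivative f x) (at x)" for x
      using F by (simp add: has_real_derivative_iff_has_vector_derivative)
    show "set_integrable lborel (einterval (-\<infinity>) \<infinity>) f"
      using f(2) by (simp add: set_integrable_def einterval_def)
    show "((F \<circ> real_of_ereal) \<longlongrightarrow> A) (at_right (-\<infinity>))"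
      using A by (simp add: ereal_tendsto_simps1)
    show "((F \<circ> real_of_ereal) \<longlongrightarrow> B) (at_left \<infinity>)"
      using B by (simp add: ereal_tendsto_simps1)
  qed (use f in auto)
  then show ?thesis
    by (simp add: interval_lebesgue_integral_def set_lebesgue_integral_def einterval_def)
qed

text \<open>The sum of \<open>poisson_kernel t (b - s) / s\<close> over the two points \<open>s\<close> and \<open>-s\<close>, in the form that stays
  regular at \<open>s = 0\<close>: the poles cancel because \<open>poisson_kernel t (b - s)\<close> and
  \<open>poisson_kernel t (b + s)\<close> agree there.\<close>

definition folded_kernel :: "real \<Rightarrow> real \<Rightarrow> real \<Rightarrow> real" where
  "folded_kernel t b s = 4 * b * t / (pi * (t\<^sup>2 + (b - s)\<^sup>2) * (t\<^sup>2 + (b + s)\<^sup>2))"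

lemma folded_kernel_measurable [measurable]: "folded_kernel t b \<in> borel_measurable borel"
  unfolding folded_kernel_def by measurable

lemma folded_kernel_eq:
  assumes "t > 0" "s \<noteq> 0"
  shows "folded_kernel t b s = poisson_kernel t (b - s) / s + poisson_kernel t (b + s) / (- s)"
proof -
  define M P where "M = t\<^sup>2 + (b - s)\<^sup>2" and "P = t\<^sup>2 + (b + s)\<^sup>2"
  have MP: "M > 0" "P > 0" "P - M = 4 * b * s"
    unfolding M_def P_def by (fact sum_sq_pos[OF assms(1)])+ (simp add: power2_eq_square algebra_simps)
  have "t / (pi * M) / s + t / (pi * P) / (- s) = t * (P - M) / (pi * M * P * s)"
    using MP(1,2) assms(2) by (simp add: field_simps)
  also have "\<dots> = 4 * b * t / (pi * M * P)"
    unfolding MP(3) using assms(2) by (simp add: mult_ac)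
  finally show ?thesis by (simp add: folded_kernel_def poisson_kernel_def M_def P_def)
qed

lemma folded_kernel_le:
  assumes "t > 0"
  shows "\<bar>folded_kernel t b s\<bar> \<le> 4 * \<bar>b\<bar> / (t * pi) * (1 / (t\<^sup>2 + (b - s)\<^sup>2))"
proof -
  define M P where "M = t\<^sup>2 + (b - s)\<^sup>2" and "P = t\<^sup>2 + (b + s)\<^sup>2"
  have MP: "M > 0" "P > 0" "P \<ge> t\<^sup>2"
    using sum_sq_pos[OF assms(1)] by (auto simp: M_def P_def)
  have "\<bar>folded_kernel t b s\<bar> = 4 * \<bar>b\<bar> * t / (pi * M * P)"
    using MP assms by (simp add: folded_kernel_def M_def[symmetric] P_def[symmetric] abs_mult)
  also have "\<dots> \<le> 4 * \<bar>b\<bar> * t / (pi * M * t\<^sup>2)"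
    using MP assms by (intro divide_left_mono mult_left_mono) auto
  also have "\<dots> = 4 * \<bar>b\<bar> / (t * pi) * (1 / M)"
    using assms by (simp add: power2_eq_square field_simps)
  finally show ?thesis by (simp add: M_def)
qed

lemma folded_kernel_near_0_le:
  assumes "t > 0" "\<bar>s\<bar> \<le> t"
  shows "\<bar>folded_kernel t b s\<bar> \<le> 6 / (t\<^sup>2 + b\<^sup>2)"
proof -
  define M P N where "M = t\<^sup>2 + (b - s)\<^sup>2" and "P = t\<^sup>2 + (b + s)\<^sup>2" and "N = t\<^sup>2 + b\<^sup>2"
  have pos: "M > 0" "P > 0" "N > 0" using sum_sq_pos[OF assms(1)] by (auto simp: M_def P_def N_def)
  have *: "N \<le> 3 * M" "N \<le> 3 * P"
    using cauchy_kernel_shift[of t s b] cauchy_kernel_shift[of t "-s" b] assms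
    by (auto simp: M_def P_def N_def)
  have bt: "2 * (\<bar>b\<bar> * t) \<le> N"
  proof -
    have "0 \<le> (\<bar>b\<bar> - t)\<^sup>2" by simp
    then show ?thesis by (simp add: N_def power2_diff)
  qed
  have NN: "N * N \<le> 9 * (M * P)" using mult_mono[OF *] pos by simp
  have "\<bar>folded_kernel t b s\<bar> = 2 * (2 * (\<bar>b\<bar> * t)) / (pi * (M * P))"
    using pos assms by (simp add: folded_kernel_def M_def[symmetric] P_def[symmetric] abs_mult mult_ac)
  also have "\<dots> \<le> 2 * N / (3 * (M * P))"
    using bt pos pi_gt3 by (intro frac_le mult_left_mono mult_right_mono) auto
  also have "\<dots> \<le> 2 * N / (3 * (N * N / 9))"
    using NN pos by (intro divide_left_mono mult_left_mono) auto
  also have "\<dots> = 6 / N" using pos by simp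
  finally show ?thesis by (simp add: N_def)
qed

text \<open>Half of this integral is the principal value of \<open>poisson_kernel t (b - s) / s\<close>. So the lemma says
  that the Hilbert transform of the Poisson kernel is the conjugate Poisson kernel.\<close>

lemma has_integral_folded_kernel:
  assumes t: "t > 0"
  shows "has_bochner_integral lborel (folded_kernel t b) (2 * conj_kernel t b)"
proof -
  \<comment> \<open>The antiderivative that partial fractions give. It is odd; the logarithms cancel at infinity
    and the arc tangents contribute \<open>\<pi>\<close>.\<close>
  define F where "F = (\<lambda>s. t / (pi * (t\<^sup>2 + b\<^sup>2)) *
    ((ln (t\<^sup>2 + (s + b)\<^sup>2) - ln (t\<^sup>2 + (s - b)\<^sup>2)) / 2 + b / t * (arctan ((s - b) / t) + arctan ((s + b) / t))))"
  note pos = sum_sq_pos[OF t]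
  have int: "integrable lborel (folded_kernel t b)"
  proof (rule Bochner_Integration.integrable_bound)
    show "integrable lborel (\<lambda>s. 4 * \<bar>b\<bar> / (t * pi) * (1 / (t\<^sup>2 + (b - s)\<^sup>2)))"
      using has_integral_reflect_translate[OF has_integral_cauchy[OF t], of b]
      by (intro integrable_mult_right) (simp add: has_bochner_integral_iff)
    show "AE s in lborel. norm (folded_kernel t b s) \<le> norm (4 * \<bar>b\<bar> / (t * pi) * (1 / (t\<^sup>2 + (b - s)\<^sup>2)))"
      unfolding real_norm_def
      by (intro AE_I2 order_trans[OF folded_kernel_le[OF t] abs_ge_self])
  qed measurable
  have der: "(F has_real_derivative folded_kernel t b s) (at s)" for s
  proof -
    define M P N where "M = t\<^sup>2 + (s - b)\<^sup>2" and "P = t\<^sup>2 + (s + b)\<^sup>2" and "N = t\<^sup>2 + b\<^sup>2"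
    have MPN: "M > 0" "P > 0" "N > 0" using pos by (auto simp: M_def P_def N_def)
    have arc: "((\<lambda>s. arctan ((s + c) / t)) has_real_derivative t / (t\<^sup>2 + (s + c)\<^sup>2)) (at s)" for c
    proof -
      have "((\<lambda>s. arctan ((s + c) / t)) has_real_derivative inverse (1 + ((s + c) / t)\<^sup>2) * (1 / t)) (at s)"
        by (auto intro!: derivative_eq_intros simp: divide_inverse)
      also have "inverse (1 + ((s + c) / t)\<^sup>2) * (1 / t) = t / (t\<^sup>2 + (s + c)\<^sup>2)"
      proof -
        have "1 + ((s + c) / t)\<^sup>2 = (t\<^sup>2 + (s + c)\<^sup>2) / t\<^sup>2"
          using t by (simp add: power_divide field_simps)
        then show ?thesis using t by (simp add: power2_eq_square)
      qed
      finally show ?thesis .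
    qed
    have ln: "((\<lambda>s. ln (t\<^sup>2 + (s + c)\<^sup>2)) has_real_derivative 2 * (s + c) / (t\<^sup>2 + (s + c)\<^sup>2)) (at s)" for c
      using pos[of "s + c"] by (auto intro!: derivative_eq_intros)
    have "(F has_real_derivative t / (pi * N) * ((2 * (s + b) / P - 2 * (s - b) / M) / 2 + b / t * (t / M + t / P))) (at s)"
      unfolding F_def M_def P_def N_def
      using arc[of "-b"] arc[of b] ln[of "-b"] ln[of b]
      by (intro DERIV_cmult DERIV_add DERIV_diff DERIV_cdivide) auto
    also have "t / (pi * N) * ((2 * (s + b) / P - 2 * (s - b) / M) / 2 + b / t * (t / M + t / P))
        = t / (pi * N) * (((s + 2 * b) * M + (2 * b - s) * P) / (M * P))"
      using MPN t by (simp add: field_simps)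
    also have "(s + 2 * b) * M + (2 * b - s) * P = 4 * b * N"
      by (simp add: M_def P_def N_def power2_eq_square algebra_simps)
    also have "t / (pi * N) * (4 * b * N / (M * P)) = folded_kernel t b s"
      using MPN by (simp add: folded_kernel_def M_def P_def power2_commute[of b s] add.commute[of b s] mult_ac)
    finally show ?thesis .
  qed
  have top: "(F \<longlongrightarrow> conj_kernel t b) at_top"
  proof -
    have l: "((\<lambda>s. ln (t\<^sup>2 + (s + b)\<^sup>2) - ln (t\<^sup>2 + (s - b)\<^sup>2)) \<longlongrightarrow> 0) at_top"
      using t by real_asymp
    have a: "((\<lambda>s. arctan ((s + c) / t)) \<longlongrightarrow> pi / 2) at_top" for c
      using t by real_asymp
    have "(F \<longlongrightarrow> t / (pi * (t\<^sup>2 + b\<^sup>2)) * (0 / 2 + b / t * (pi / 2 + pi / 2))) at_top"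
      unfolding F_def using a[of b] a[of "-b"]
      by (intro tendsto_intros l) auto
    then show ?thesis using t by (simp add: conj_kernel_def)
  qed
  have odd: "F (- s) = - F s" for s
  proof -
    have "arctan ((- s - b) / t) = - arctan ((s + b) / t)" "arctan ((- s + b) / t) = - arctan ((s - b) / t)"
      by (simp_all add: arctan_minus[symmetric] minus_divide_left del: arctan_minus)
    moreover have "(- s + b)\<^sup>2 = (s - b)\<^sup>2" "(- s - b)\<^sup>2 = (s + b)\<^sup>2"
      by (simp_all add: power2_eq_square algebra_simps)
    moreover have "c * ((y - x) / 2 + d * (- p + - q)) = - (c * ((x - y) / 2 + d * (q + p)))" for c d x y p q :: real
      by (simp add: algebra_simps diff_divide_distrib)
    ultimately show ?thesis unfolding F_def by (simp only:)
  qed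
  have bot: "(F \<longlongrightarrow> - conj_kernel t b) at_bot"
    using tendsto_minus[OF top] by (simp add: filterlim_at_bot_mirror odd)
  have cont: "isCont (folded_kernel t b) s" for s
    using pos[of "b - s"] pos[of "b + s"] unfolding folded_kernel_def
    by (intro continuous_intros) (auto simp: add_eq_0_iff_both_eq_0)
  have "(LBINT s. folded_kernel t b s) = conj_kernel t b - (- conj_kernel t b)"
    by (rule integral_FTC_line[OF der cont int bot top])
  then show ?thesis using int by (simp add: has_bochner_integral_iff)
qed

text \<open>Reflecting \<open>s\<close> turns twice the truncated integral into the integral of the folded kernel outside
  \<open>[-\<epsilon>, \<epsilon>]\<close>. The missing window has length \<open>2 \<epsilon>\<close>, and there the folded kernel is at most a multiple of
  \<open>1 / (t\<^sup>2 + b\<^sup>2)\<close>.\<close>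

lemma truncated_hilbert_poisson_kernel:
  assumes t: "t > 0" and e: "0 < \<epsilon>" "\<epsilon> \<le> t"
  shows "integrable lborel (\<lambda>s. indicator {s. \<epsilon> < \<bar>s\<bar>} s * (poisson_kernel t (b - s) / s))"
    and "\<bar>(LBINT s. indicator {s. \<epsilon> < \<bar>s\<bar>} s * (poisson_kernel t (b - s) / s)) - conj_kernel t b\<bar>
      \<le> 6 * \<epsilon> / (t\<^sup>2 + b\<^sup>2)"
proof -
  define k where "k = (\<lambda>b s. indicator {s. \<epsilon> < \<bar>s\<bar>} s * (poisson_kernel t (b - s) / s))"
  have int: "integrable lborel (k b)" for b
  proof (rule Bochner_Integration.integrable_bound)
    show "integrable lborel (\<lambda>s. 1 / \<epsilon> * poisson_kernel t (b - s))"
      using has_integral_poisson_kernel[OF t, of b]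
      by (intro integrable_mult_right) (simp add: has_bochner_integral_iff)
    have "\<bar>k b s\<bar> \<le> 1 / \<epsilon> * poisson_kernel t (b - s)" for s
    proof (cases "\<epsilon> < \<bar>s\<bar>")
      case True
      then have "poisson_kernel t (b - s) / \<bar>s\<bar> \<le> poisson_kernel t (b - s) / \<epsilon>"
        using e poisson_kernel_nonneg[OF t] by (intro divide_left_mono) auto
      then show ?thesis using True poisson_kernel_nonneg[OF t] by (simp add: k_def abs_mult)
    qed (use e poisson_kernel_nonneg[OF t] in \<open>simp add: k_def\<close>)
    then show "AE s in lborel. norm (k b s) \<le> norm (1 / \<epsilon> * poisson_kernel t (b - s))"
      unfolding real_norm_def by (intro AE_I2) (rule order_trans[OF _ abs_ge_self])
  qed (simp add: k_def)
  then show "integrable lborel (\<lambda>s. indicator {s. \<epsilon> < \<bar>s\<bar>} s * (poisson_kernel t (b - s) / s))"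
    by (simp add: k_def)
  have int': "integrable lborel (\<lambda>s. k b (- s))"
    using integrable_reflect_translate[of "k b" 0] int by simp
  define near where "near = (\<lambda>s. folded_kernel t b s * indicator {- \<epsilon>..\<epsilon>} s)"
  have nearI: "integrable lborel near"
    using has_integral_folded_kernel[OF t, of b]
    unfolding near_def has_bochner_integral_iff
    by (intro integrable_real_mult_indicator) auto
  have "2 * (LBINT s. k b s) = (LBINT s. k b s) + (LBINT s. k b (- s))"
    using integral_reflect_translate[of "k b" 0] by simp
  also have "\<dots> = (LBINT s. k b s + k b (- s))"
    using int int' by simp
  also have "(\<lambda>s. k b s + k b (- s)) = (\<lambda>s. folded_kernel t b s - near s)"
  proof
    fix s
    show "k b s + k b (- s) = folded_kernel t b s - near s"
    proof (cases "\<epsilon> < \<bar>s\<bar>")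
      case True
      then have "s \<noteq> 0" "s \<notin> {- \<epsilon>..\<epsilon>}" using e by auto
      then show ?thesis using True folded_kernel_eq[OF t, of s b] by (simp add: k_def near_def)
    next
      case False
      then have "s \<in> {- \<epsilon>..\<epsilon>}" by auto
      then show ?thesis using False by (simp add: k_def near_def)
    qed
  qed
  also have "(LBINT s. folded_kernel t b s - near s) = 2 * conj_kernel t b - (LBINT s. near s)"
    using has_integral_folded_kernel[OF t, of b] nearI by (simp add: has_bochner_integral_iff)
  finally have eq: "(LBINT s. k b s) - conj_kernel t b = - (LBINT s. near s) / 2" by simp
  have "\<bar>LBINT s. near s\<bar> \<le> (LBINT s. \<bar>near s\<bar>)"
    using integral_norm_bound[of lborel near] by simp
  also have "\<dots> \<le> (LBINT s. 6 / (t\<^sup>2 + b\<^sup>2) * indicator {- \<epsilon>..\<epsilon>} s)"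
  proof (rule integral_mono)
    show "\<bar>near s\<bar> \<le> 6 / (t\<^sup>2 + b\<^sup>2) * indicator {- \<epsilon>..\<epsilon>} s" for s
      using folded_kernel_near_0_le[OF t, of s b] e by (auto simp: near_def indicator_def)
    show "integrable lborel (\<lambda>s. 6 / (t\<^sup>2 + b\<^sup>2) * indicator {- \<epsilon>..\<epsilon>} s)"
      by (intro integrable_mult_right integrable_real_indicator) (auto simp: emeasure_lborel_Icc_eq)
  qed (use nearI in simp)
  also have "\<dots> = 12 * \<epsilon> / (t\<^sup>2 + b\<^sup>2)" using e by simp
  finally show "\<bar>(LBINT s. indicator {s. \<epsilon> < \<bar>s\<bar>} s * (poisson_kernel t (b - s) / s)) - conj_kernel t b\<bar>
      \<le> 6 * \<epsilon> / (t\<^sup>2 + b\<^sup>2)"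
    using eq by (simp add: k_def)
qed

text \<open>The contribution of the regularising term \<open>u / (u\<^sup>2 + 1)\<close> of the modified Hilbert transform. It does
  not depend on the point \<open>x\<close> at which the transform is taken, so it drops out of the derivative.\<close>

definition poisson_mod :: "real \<Rightarrow> real \<Rightarrow> real" where
  "poisson_mod t y = (LBINT u. u / (u\<^sup>2 + 1) * poisson_kernel t (u - y))"

definition truncated_hilbert_kernel :: "real \<Rightarrow> real \<Rightarrow> real \<Rightarrow> real" where
  "truncated_hilbert_kernel \<epsilon> x u = indicator {u. \<epsilon> < \<bar>x - u\<bar>} u * (1 / (x - u) + u / (u\<^sup>2 + 1))"

lemma truncated_hilbert_kernel_measurable [measurable]:
  "truncated_hilbert_kernel \<epsilon> x \<in> borel_measurable borel"
  unfolding truncated_hilbert_kernel_def by measurable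

text \<open>The two terms of the kernel add up to \<open>(1 + x u) / ((x - u) (1 + u\<^sup>2))\<close>, and
  \<open>(1 + x u) / (x - u) = (1 + x\<^sup>2) / (x - u) - x\<close> is bounded off the singularity. The bound is written
  with the Cauchy kernel centred at \<open>0\<close>, to fit \<open>integrable_mult_kernel\<close>.\<close>

lemma truncated_hilbert_kernel_le:
  assumes "\<epsilon> > 0"
  shows "\<bar>truncated_hilbert_kernel \<epsilon> x u\<bar> \<le> ((1 + x\<^sup>2) / \<epsilon> + \<bar>x\<bar>) / (1\<^sup>2 + (0 - u)\<^sup>2)"
proof (cases "\<epsilon> < \<bar>x - u\<bar>")
  case True
  then have ne: "x - u \<noteq> 0" using assms by auto
  have u: "1 + u\<^sup>2 > 0" by (simp add: add_pos_nonneg)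
  have "1 / (x - u) + u / (u\<^sup>2 + 1) = ((1 + x\<^sup>2) / (x - u) - x) / (1 + u\<^sup>2)"
    using ne u by (simp add: divide_simps add.commute) (simp add: power2_eq_square algebra_simps)
  moreover have "\<bar>(1 + x\<^sup>2) / (x - u) - x\<bar> \<le> (1 + x\<^sup>2) / \<epsilon> + \<bar>x\<bar>"
  proof -
    have "\<bar>(1 + x\<^sup>2) / (x - u)\<bar> = (1 + x\<^sup>2) / \<bar>x - u\<bar>" by (simp add: abs_divide)
    also have "\<dots> \<le> (1 + x\<^sup>2) / \<epsilon>" using True assms by (intro divide_left_mono) auto
    finally show ?thesis by linarith
  qed
  ultimately show ?thesis using True u
    by (simp add: truncated_hilbert_kernel_def abs_divide divide_right_mono)
next
  case False
  then show ?thesis using assms by (simp add: truncated_hilbert_kernel_def)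
qed

text \<open>The error has two sources, both of the stated order: the truncated part \<open>1 / (x - u)\<close>, which the
  substitution \<open>s = x - u\<close> reduces to \<open>truncated_hilbert_poisson_kernel\<close>, and the window
  \<open>\<bar>x - u\<bar> \<le> \<epsilon>\<close> that the truncation removes from \<open>poisson_mod\<close>.\<close>

lemma truncated_hilbert_kernel_poisson:
  assumes t: "t > 0" and e: "0 < \<epsilon>" "\<epsilon> \<le> t"
  shows "\<bar>(LBINT u. truncated_hilbert_kernel \<epsilon> x u * poisson_kernel t (u - y))
            - (conj_kernel t (x - y) + poisson_mod t y)\<bar>
      \<le> (6 + 2 * t) * \<epsilon> / (t\<^sup>2 + (x - y)\<^sup>2)"
proof -
  define N where "N = t\<^sup>2 + (x - y)\<^sup>2"
  have N: "N > 0" using sum_sq_pos[OF t] by (simp add: N_def)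
  define A where "A = (\<lambda>u. indicator {u. \<epsilon> < \<bar>x - u\<bar>} u * (poisson_kernel t (u - y) / (x - u)))"
  define B where "B = (\<lambda>u. u / (u\<^sup>2 + 1) * poisson_kernel t (u - y))"
  define near where "near = (\<lambda>u. B u * indicator {x - \<epsilon>..x + \<epsilon>} u)"
  have A_eq: "A = (\<lambda>u. (\<lambda>s. indicator {s. \<epsilon> < \<bar>s\<bar>} s * (poisson_kernel t ((x - y) - s) / s)) (x - u))"
    by (auto simp: A_def fun_eq_iff indicator_def)
  have AI: "integrable lborel A"
    unfolding A_eq using truncated_hilbert_poisson_kernel(1)[OF assms]
    by (subst integrable_reflect_translate)
  have A_le: "\<bar>(LBINT u. A u) - conj_kernel t (x - y)\<bar> \<le> 6 * \<epsilon> / N"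
    unfolding A_eq N_def
    by (subst integral_reflect_translate) (rule truncated_hilbert_poisson_kernel(2)[OF assms])
  have phi: "\<bar>u / (u\<^sup>2 + 1)\<bar> \<le> 1" for u :: real
  proof -
    have "0 \<le> (\<bar>u\<bar> - 1)\<^sup>2" by simp
    then have "2 * \<bar>u\<bar> \<le> u\<^sup>2 + 1" by (simp add: power2_diff)
    then have "\<bar>u\<bar> \<le> u\<^sup>2 + 1" by linarith
    moreover have "0 < u\<^sup>2 + 1" by (simp add: add_nonneg_pos)
    ultimately show ?thesis by (simp add: abs_divide)
  qed
  have B_le: "\<bar>B u\<bar> \<le> poisson_kernel t (y - u)" for u
    using mult_right_mono[OF phi poisson_kernel_nonneg[OF t]] poisson_kernel_nonneg[OF t, of "y - u"]
      poisson_kernel_minus[of t "u - y"]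
    by (simp add: B_def abs_mult)
  have BI: "integrable lborel B"
  proof (rule Bochner_Integration.integrable_bound)
    show "integrable lborel (\<lambda>u. poisson_kernel t (y - u))"
      using has_integral_poisson_kernel[OF t, of y] by (simp add: has_bochner_integral_iff)
    show "AE u in lborel. norm (B u) \<le> norm (poisson_kernel t (y - u))"
      unfolding real_norm_def by (intro AE_I2 order_trans[OF B_le abs_ge_self])
  qed (simp add: B_def)
  have nearI: "integrable lborel near"
    unfolding near_def by (intro integrable_real_mult_indicator BI) auto
  have near_le: "\<bar>near u\<bar> \<le> t / N * indicator {x - \<epsilon>..x + \<epsilon>} u" for u
  proof (cases "u \<in> {x - \<epsilon>..x + \<epsilon>}")
    case True
    have "N \<le> 3 * (t\<^sup>2 + (y - u)\<^sup>2)"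
      using cauchy_kernel_shift[OF t, of "x - u" "x - y"] True e
      by (auto simp: N_def power2_commute[of u y])
    then have "N \<le> pi * (t\<^sup>2 + (y - u)\<^sup>2)"
      using pi_gt3 mult_right_mono[of 3 pi "t\<^sup>2 + (y - u)\<^sup>2"] by auto
    then have "poisson_kernel t (y - u) \<le> t / N"
      unfolding poisson_kernel_def using N t by (intro divide_left_mono) auto
    then show ?thesis using True B_le[of u] by (simp add: near_def)
  qed (simp add: near_def)
  have "\<bar>LBINT u. near u\<bar> \<le> (LBINT u. \<bar>near u\<bar>)"
    using integral_norm_bound[of lborel near] by simp
  also have "\<dots> \<le> (LBINT u. t / N * indicator {x - \<epsilon>..x + \<epsilon>} u)"
    using nearI by (intro integral_mono near_le integrable_mult_right integrable_real_indicator) (auto simp: emeasure_lborel_Icc_eq)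
  also have "\<dots> = 2 * t * \<epsilon> / N" using e by simp
  finally have near: "\<bar>LBINT u. near u\<bar> \<le> 2 * t * \<epsilon> / N" .
  have "(\<lambda>u. truncated_hilbert_kernel \<epsilon> x u * poisson_kernel t (u - y)) = (\<lambda>u. A u + B u - near u)"
    by (auto simp: fun_eq_iff truncated_hilbert_kernel_def A_def B_def near_def indicator_def algebra_simps)
  then have "(LBINT u. truncated_hilbert_kernel \<epsilon> x u * poisson_kernel t (u - y))
      = (LBINT u. A u) + poisson_mod t y - (LBINT u. near u)"
    using AI BI nearI by (simp add: poisson_mod_def B_def)
  then have "\<bar>(LBINT u. truncated_hilbert_kernel \<epsilon> x u * poisson_kernel t (u - y))
            - (conj_kernel t (x - y) + poisson_mod t y)\<bar> \<le> 6 * \<epsilon> / N + 2 * t * \<epsilon> / N"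
    using A_le near by linarith
  also have "\<dots> = (6 + 2 * t) * \<epsilon> / N" by (simp add: add_divide_distrib algebra_simps)
  finally show ?thesis by (simp add: N_def)
qed

lemma poisson_mod_measurable [measurable]: "poisson_mod t \<in> borel_measurable borel"
  unfolding poisson_mod_def by measurable

section \<open>Poisson transforms of Hoelder functions\<close>

locale hoelder_function =
  fixes f :: "real \<Rightarrow> real" and K \<alpha> :: real
  assumes \<alpha>_pos: "0 < \<alpha>" and \<alpha>_less_1: "\<alpha> < 1"
    and hoelder: "\<bar>f x - f y\<bar> \<le> K * \<bar>x - y\<bar> powr \<alpha>"
begin

lemma K_nonneg: "K \<ge> 0"
  using hoelder[of 0 1] by simp

lemma measurable_f [measurable]: "f \<in> borel_measurable borel"
proof -
  have "isCont f x" for x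
  proof -
    have "((\<lambda>y. K * \<bar>y - x\<bar> powr \<alpha>) \<longlongrightarrow> 0) (at x)"
    proof -
      have "((\<lambda>y. K * \<bar>y - x\<bar> powr \<alpha>) \<longlongrightarrow> K * \<bar>x - x\<bar> powr \<alpha>) (at x)"
        using \<alpha>_pos by (intro tendsto_intros tendsto_powr2) auto
      then show ?thesis by simp
    qed
    then have "((\<lambda>y. f y - f x) \<longlongrightarrow> 0) (at x)"
      by (rule Lim_null_comparison[rotated]) (use hoelder in auto)
    then show ?thesis unfolding isCont_def by (rule LIM_zero_cancel)
  qed
  then show ?thesis
    by (intro borel_measurable_continuous_onI) (simp add: continuous_at_imp_continuous_on)
qed

lemma hoelder_function_abs: "hoelder_function (\<lambda>x. \<bar>f x\<bar>) K \<alpha>"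
  using \<alpha>_pos \<alpha>_less_1 hoelder by unfold_locales (auto intro: order_trans[OF abs_triangle_ineq3])

lemma cos_half_pi_\<alpha>_pos: "cos (pi * \<alpha> / 2) > 0"
proof (rule cos_gt_zero_pi)
  have "0 < pi * \<alpha>" "pi * \<alpha> < pi * 1"
    using \<alpha>_pos \<alpha>_less_1 by (auto simp del: mult_1_right)
  then show "- (pi / 2) < pi * \<alpha> / 2" "pi * \<alpha> / 2 < pi / 2"
    using pi_gt_zero by linarith+
qed

lemma has_integral_powr_cauchy_at:
  assumes "t > 0"
  shows "has_bochner_integral lborel (\<lambda>y. \<bar>x - y\<bar> powr \<alpha> / (t\<^sup>2 + (x - y)\<^sup>2))
           (pi * t powr (\<alpha> - 1) / cos (pi * \<alpha> / 2))"
  using has_integral_reflect_translate[OF has_integral_powr_cauchy[of \<alpha> t], of x] \<alpha>_pos \<alpha>_less_1 assms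
  by simp

text \<open>A Hoelder function grows at most like \<open>\<bar>y\<bar>\<^sup>\<alpha>\<close> with \<open>\<alpha> < 1\<close>, so it can be integrated against
  anything that decays like \<open>y\<^sup>-\<^sup>2\<close>.\<close>

lemma integrable_mult_kernel:
  assumes t: "t > 0" and k [measurable]: "k \<in> borel_measurable borel"
    and k_le: "\<And>y. \<bar>k y\<bar> \<le> C / (t\<^sup>2 + (x - y)\<^sup>2)"
  shows "integrable lborel (\<lambda>y. f y * k y)"
proof (rule Bochner_Integration.integrable_bound)
  define c where "c = (\<lambda>y. 1 / (t\<^sup>2 + (x - y)\<^sup>2))"
  have "integrable lborel c"
    using has_integral_reflect_translate[OF has_integral_cauchy[OF t], of x]
    by (simp add: c_def has_bochner_integral_iff)
  moreover have "integrable lborel (\<lambda>y. \<bar>x - y\<bar> powr \<alpha> / (t\<^sup>2 + (x - y)\<^sup>2))"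
    using has_integral_powr_cauchy_at[OF t, of x] by (simp add: has_bochner_integral_iff)
  ultimately show "integrable lborel (\<lambda>y. C * \<bar>f x\<bar> * c y + C * K * (\<bar>x - y\<bar> powr \<alpha> / (t\<^sup>2 + (x - y)\<^sup>2)))"
    by (intro Bochner_Integration.integrable_add integrable_mult_right)
  show "AE y in lborel. norm (f y * k y)
      \<le> norm (C * \<bar>f x\<bar> * c y + C * K * (\<bar>x - y\<bar> powr \<alpha> / (t\<^sup>2 + (x - y)\<^sup>2)))"
  proof (rule AE_I2)
    fix y
    have "\<bar>f y\<bar> \<le> \<bar>f x\<bar> + K * \<bar>x - y\<bar> powr \<alpha>" using hoelder[of x y] by linarith
    then have "\<bar>f y\<bar> * \<bar>k y\<bar> \<le> (\<bar>f x\<bar> + K * \<bar>x - y\<bar> powr \<alpha>) * (C / (t\<^sup>2 + (x - y)\<^sup>2))"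
      using k_le[of y] by (intro mult_mono) auto
    also have "\<dots> = C * \<bar>f x\<bar> * c y + C * K * (\<bar>x - y\<bar> powr \<alpha> / (t\<^sup>2 + (x - y)\<^sup>2))"
      by (simp add: c_def algebra_simps add_divide_distrib)
    finally show "norm (f y * k y)
      \<le> norm (C * \<bar>f x\<bar> * c y + C * K * (\<bar>x - y\<bar> powr \<alpha> / (t\<^sup>2 + (x - y)\<^sup>2)))"
      by (simp add: abs_mult)
  qed
qed measurable

lemma L1_weighted_f: "L1_weighted f"
proof -
  have "integrable lborel (\<lambda>x. f x * (1 / (1\<^sup>2 + (0 - x)\<^sup>2)))"
    by (rule integrable_mult_kernel[where t = 1 and C = 1 and x = 0]) auto
  moreover have "japanese_bracket x powr (-2) = 1 / (1\<^sup>2 + (0 - x)\<^sup>2)" for x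
  proof -
    have pos: "0 < 1 + x\<^sup>2" by (simp add: add_pos_nonneg)
    then have "japanese_bracket x powr 2 = 1 + x\<^sup>2"
      by (simp add: japanese_bracket_def powr_numeral)
    then show ?thesis by (simp add: powr_minus_divide)
  qed
  ultimately show ?thesis by (simp add: L1_weighted_def integrable_completion)
qed

text \<open>The estimate behind both bounds. The left-hand side is the integral of \<open>(f y - f x) * k y\<close>, where
  the Hoelder condition makes the power moment of the Cauchy kernel appear. It will be used with a
  multiple of the Poisson kernel and with the derivative of the conjugate kernel.\<close>

lemma abs_integral_minus_mean_le:
  assumes t: "t > 0" and k: "k \<in> borel_measurable borel"
    and k_le: "\<And>y. \<bar>k y\<bar> \<le> 1 / (t\<^sup>2 + (x - y)\<^sup>2)"
    and k_int: "integrable lborel k"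
  shows "\<bar>(LBINT y. f y * k y) - f x * (LBINT y. k y)\<bar> \<le> K * (pi * t powr (\<alpha> - 1) / cos (pi * \<alpha> / 2))"
proof -
  note h = has_integral_powr_cauchy_at[OF t, of x]
  have fk: "integrable lborel (\<lambda>y. f y * k y)"
    by (rule integrable_mult_kernel[OF t k k_le])
  have I: "integrable lborel (\<lambda>y. (f y - f x) * k y)"
    using fk k_int by (simp add: left_diff_distrib)
  have "(LBINT y. f y * k y) - f x * (LBINT y. k y) = (LBINT y. (f y - f x) * k y)"
    using fk k_int by (simp add: left_diff_distrib)
  also have "\<bar>\<dots>\<bar> \<le> (LBINT y. \<bar>(f y - f x) * k y\<bar>)"
    using integral_norm_bound[of lborel "\<lambda>y. (f y - f x) * k y"] by simp
  also have "\<dots> \<le> (LBINT y. K * (\<bar>x - y\<bar> powr \<alpha> / (t\<^sup>2 + (x - y)\<^sup>2)))"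
  proof (rule integral_mono)
    fix y
    have "\<bar>f y - f x\<bar> * \<bar>k y\<bar> \<le> (K * \<bar>x - y\<bar> powr \<alpha>) * (1 / (t\<^sup>2 + (x - y)\<^sup>2))"
      using hoelder[of y x] k_le[of y] K_nonneg by (intro mult_mono) (auto simp: abs_minus_commute)
    then show "\<bar>(f y - f x) * k y\<bar> \<le> K * (\<bar>x - y\<bar> powr \<alpha> / (t\<^sup>2 + (x - y)\<^sup>2))"
      by (simp add: abs_mult)
    show "integrable lborel (\<lambda>y. K * (\<bar>x - y\<bar> powr \<alpha> / (t\<^sup>2 + (x - y)\<^sup>2)))"
      using h by (intro integrable_mult_right) (simp add: has_bochner_integral_iff)
  qed (use I in simp)
  also have "\<dots> = K * (pi * t powr (\<alpha> - 1) / cos (pi * \<alpha> / 2))"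
    by (rule has_bochner_integral_integral_eq[OF has_bochner_integral_mult_right[OF h]])
  finally show ?thesis .
qed

lemma poisson_eq: "poisson t f x = (LBINT y. f y * poisson_kernel t (x - y))"
proof -
  have "(\<lambda>y. t * f y / (pi * (t\<^sup>2 + (x - y)\<^sup>2))) = (\<lambda>y. f y * poisson_kernel t (x - y))"
    by (simp add: fun_eq_iff poisson_kernel_def)
  then show ?thesis unfolding poisson_def by (simp add: integral_completion)
qed

lemma integrable_mult_poisson_kernel:
  assumes "t > 0"
  shows "integrable lborel (\<lambda>y. f y * poisson_kernel t (x - y))"
proof (rule integrable_mult_kernel[OF assms])
  show "\<bar>poisson_kernel t (x - y)\<bar> \<le> (t / pi) / (t\<^sup>2 + (x - y)\<^sup>2)" for y
    using assms by (simp add: poisson_kernel_def)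
qed measurable

lemma poisson_approx:
  assumes t: "t > 0"
  shows "\<bar>poisson t f x - f x\<bar> \<le> K * t powr \<alpha> / cos (pi * \<alpha> / 2)"
proof -
  define k where "k = (\<lambda>y. 1 / (t\<^sup>2 + (x - y)\<^sup>2))"
  have k: "has_bochner_integral lborel k (pi / t)"
    using has_integral_reflect_translate[OF has_integral_cauchy[OF t], of x] by (simp add: k_def)
  have p: "poisson t f x = t / pi * (LBINT y. f y * k y)"
  proof -
    have "(\<lambda>y. f y * poisson_kernel t (x - y)) = (\<lambda>y. t / pi * (f y * k y))"
      by (simp add: fun_eq_iff poisson_kernel_def k_def)
    then show ?thesis by (simp add: poisson_eq)
  qed
  have "\<bar>(LBINT y. f y * k y) - f x * (LBINT y. k y)\<bar> \<le> K * (pi * t powr (\<alpha> - 1) / cos (pi * \<alpha> / 2))"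
    using k by (intro abs_integral_minus_mean_le[OF t]) (auto simp: k_def has_bochner_integral_iff)
  then have "t / pi * \<bar>(LBINT y. f y * k y) - f x * (pi / t)\<bar>
      \<le> t / pi * (K * (pi * t powr (\<alpha> - 1) / cos (pi * \<alpha> / 2)))"
    using k t by (intro mult_left_mono) (auto simp: has_bochner_integral_iff)
  moreover have "t / pi * \<bar>(LBINT y. f y * k y) - f x * (pi / t)\<bar> = \<bar>poisson t f x - f x\<bar>"
  proof -
    have "t / pi * \<bar>(LBINT y. f y * k y) - f x * (pi / t)\<bar> = \<bar>t / pi * ((LBINT y. f y * k y) - f x * (pi / t))\<bar>"
      using t by (simp add: abs_mult)
    also have "t / pi * ((LBINT y. f y * k y) - f x * (pi / t)) = poisson t f x - f x"
      using t unfolding p by (simp add: right_diff_distrib)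
    finally show ?thesis .
  qed
  moreover have "t powr \<alpha> = t * t powr (\<alpha> - 1)" using t by (simp add: powr_mult_base)
  ultimately show ?thesis by (simp add: mult_ac)
qed

text \<open>The Poisson transform is an average of translates of \<open>f\<close>, each of which has the same Hoelder
  constant. Hence all that holds for \<open>f\<close>, measurability and integrability in particular, holds for its
  Poisson transform.\<close>

lemma hoelder_function_poisson:
  assumes t: "t > 0"
  shows "hoelder_function (poisson t f) K \<alpha>"
proof
  fix x x'
  have p: "poisson t f x = (LBINT s. f (x - s) * poisson_kernel t s)" for x
    using integral_reflect_translate[of "\<lambda>y. f y * poisson_kernel t (x - y)" x] by (simp add: poisson_eq)
  have I: "integrable lborel (\<lambda>s. f (x - s) * poisson_kernel t s)" for x
    using integrable_reflect_translate[of "\<lambda>y. f y * poisson_kernel t (x - y)" x]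
      integrable_mult_poisson_kernel[OF t, of x] by simp
  have pk: "has_bochner_integral lborel (poisson_kernel t) 1"
    using has_integral_poisson_kernel[OF t, of 0] by (simp add: poisson_kernel_minus)
  have "\<bar>poisson t f x - poisson t f x'\<bar> = \<bar>LBINT s. (f (x - s) - f (x' - s)) * poisson_kernel t s\<bar>"
    using I by (simp add: p left_diff_distrib)
  also have "\<dots> \<le> (LBINT s. \<bar>(f (x - s) - f (x' - s)) * poisson_kernel t s\<bar>)"
    using integral_norm_bound[of lborel "\<lambda>s. (f (x - s) - f (x' - s)) * poisson_kernel t s"] by simp
  also have "\<dots> \<le> (LBINT s. K * \<bar>x - x'\<bar> powr \<alpha> * poisson_kernel t s)"
  proof (rule integral_mono)
    show "\<bar>(f (x - s) - f (x' - s)) * poisson_kernel t s\<bar> \<le> K * \<bar>x - x'\<bar> powr \<alpha> * poisson_kernel t s" for s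
      using hoelder[of "x - s" "x' - s"] poisson_kernel_nonneg[OF t, of s]
      by (simp add: abs_mult mult_right_mono)
    have "integrable lborel (\<lambda>s. (f (x - s) - f (x' - s)) * poisson_kernel t s)"
      using I by (simp add: left_diff_distrib)
    then show "integrable lborel (\<lambda>s. \<bar>(f (x - s) - f (x' - s)) * poisson_kernel t s\<bar>)" by simp
  qed (use pk in \<open>simp add: has_bochner_integral_iff\<close>)
  also have "\<dots> = K * \<bar>x - x'\<bar> powr \<alpha>" using pk by (simp add: has_bochner_integral_iff)
  finally show "\<bar>poisson t f x - poisson t f x'\<bar> \<le> K * \<bar>x - x'\<bar> powr \<alpha>" .
qed (use \<alpha>_pos \<alpha>_less_1 in auto)

section \<open>The Hilbert transform of a Poisson transform\<close>

text \<open>The double integral converges absolutely: integrating \<open>\<bar>f y\<bar>\<close> against the Poisson kernel first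
  gives the Poisson transform of \<open>\<bar>f\<bar>\<close>, which is again Hoelder, and the truncated Hilbert kernel decays
  like \<open>u\<^sup>-\<^sup>2\<close>.\<close>

lemma fubini_truncated_hilbert_poisson:
  assumes t: "t > 0" and e: "\<epsilon> > 0"
  shows "integrable lborel (\<lambda>y. f y * (LBINT u. truncated_hilbert_kernel \<epsilon> x u * poisson_kernel t (u - y)))"
    and "(LBINT u. poisson t f u * truncated_hilbert_kernel \<epsilon> x u)
       = (LBINT y. f y * (LBINT u. truncated_hilbert_kernel \<epsilon> x u * poisson_kernel t (u - y)))"
proof -
  define T where "T = truncated_hilbert_kernel \<epsilon> x"
  define N where "N = (\<lambda>(u, y). T u * (f y * poisson_kernel t (u - y)))"
  interpret absf: hoelder_function "\<lambda>x. \<bar>f x\<bar>" K \<alpha> by (rule hoelder_function_abs)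
  interpret P: hoelder_function "poisson t (\<lambda>x. \<bar>f x\<bar>)" K \<alpha> by (rule absf.hoelder_function_poisson[OF t])
  have [measurable]: "T \<in> borel_measurable borel" unfolding T_def by measurable
  have N_meas: "N \<in> borel_measurable (lborel \<Otimes>\<^sub>M lborel)" unfolding N_def by measurable
  have T_le: "\<bar>T u\<bar> \<le> ((1 + x\<^sup>2) / \<epsilon> + \<bar>x\<bar>) / (1\<^sup>2 + (0 - u)\<^sup>2)" for u
    unfolding T_def by (rule truncated_hilbert_kernel_le[OF e])
  have norm: "(LBINT y. norm (N (u, y))) = poisson t (\<lambda>x. \<bar>f x\<bar>) u * \<bar>T u\<bar>" for u
    using poisson_kernel_nonneg[OF t]
    by (simp add: N_def abs_mult absf.poisson_eq mult.commute[of _ "\<bar>T u\<bar>"])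
  have "integrable lborel (\<lambda>u. poisson t (\<lambda>x. \<bar>f x\<bar>) u * \<bar>T u\<bar>)"
    by (rule P.integrable_mult_kernel[where t = 1 and x = 0 and C = "(1 + x\<^sup>2) / \<epsilon> + \<bar>x\<bar>"])
       (use T_le in auto)
  then have "integrable (lborel \<Otimes>\<^sub>M lborel) N"
    using integrable_mult_right[OF integrable_mult_poisson_kernel[OF t]]
    by (intro lborel_pair.Fubini_integrable N_meas) (simp_all only: norm, simp add: N_def)
  then have I: "integrable (lborel \<Otimes>\<^sub>M lborel) (\<lambda>(u, y). T u * (f y * poisson_kernel t (u - y)))"
    by (simp add: N_def)
  have inner: "(LBINT u. T u * (f y * poisson_kernel t (u - y))) = f y * (LBINT u. T u * poisson_kernel t (u - y))" for y
    by (subst integral_mult_right_zero[symmetric]) (simp add: mult_ac)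
  have "integrable lborel (\<lambda>y. LBINT u. T u * (f y * poisson_kernel t (u - y)))"
    by (rule lborel_pair.integrable_snd[OF I])
  then show "integrable lborel (\<lambda>y. f y * (LBINT u. truncated_hilbert_kernel \<epsilon> x u * poisson_kernel t (u - y)))"
    unfolding inner unfolding T_def .
  have "(LBINT u. poisson t f u * T u) = (LBINT u. LBINT y. T u * (f y * poisson_kernel t (u - y)))"
    by (simp add: poisson_eq mult.commute)
  also have "\<dots> = (LBINT y. LBINT u. T u * (f y * poisson_kernel t (u - y)))"
    by (rule lborel_pair.Fubini_integral[OF I, symmetric])
  finally show "(LBINT u. poisson t f u * truncated_hilbert_kernel \<epsilon> x u)
       = (LBINT y. f y * (LBINT u. truncated_hilbert_kernel \<epsilon> x u * poisson_kernel t (u - y)))"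
    unfolding inner unfolding T_def .
qed

text \<open>Neither summand \<open>f y * conj_kernel t (x - y)\<close> nor \<open>f y * poisson_mod t y\<close> need be integrable, as
  each kernel decays only like \<open>1 / y\<close>. That their sum is integrable follows from the Fubini theorem
  for the truncated kernel, from which it differs by a kernel that decays like \<open>y\<^sup>-\<^sup>2\<close>.\<close>

lemma truncated_hilbert_poisson_approx:
  assumes t: "t > 0" and e: "0 < \<epsilon>" "\<epsilon> \<le> t"
  shows "integrable lborel (\<lambda>y. f y * (conj_kernel t (x - y) + poisson_mod t y))"
    and "\<bar>(LBINT u. poisson t f u * truncated_hilbert_kernel \<epsilon> x u)
           - (LBINT y. f y * (conj_kernel t (x - y) + poisson_mod t y))\<bar>
      \<le> (6 + 2 * t) * \<epsilon> * (LBINT y. \<bar>f y\<bar> * (1 / (t\<^sup>2 + (x - y)\<^sup>2)))"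
proof -
  interpret absf: hoelder_function "\<lambda>x. \<bar>f x\<bar>" K \<alpha> by (rule hoelder_function_abs)
  define k where "k = (\<lambda>y. LBINT u. truncated_hilbert_kernel \<epsilon> x u * poisson_kernel t (u - y))"
  define l where "l = (\<lambda>y. conj_kernel t (x - y) + poisson_mod t y)"
  have [measurable]: "k \<in> borel_measurable borel" "l \<in> borel_measurable borel"
    unfolding k_def l_def by measurable
  have kl: "\<bar>k y - l y\<bar> \<le> (6 + 2 * t) * \<epsilon> / (t\<^sup>2 + (x - y)\<^sup>2)" for y
    unfolding k_def l_def by (rule truncated_hilbert_kernel_poisson[OF assms])
  have fk: "integrable lborel (\<lambda>y. f y * k y)"
    unfolding k_def by (rule fubini_truncated_hilbert_poisson(1)[OF t e(1)])
  have fkl: "integrable lborel (\<lambda>y. f y * (k y - l y))"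
    by (rule integrable_mult_kernel[OF t _ kl]) simp
  have "integrable lborel (\<lambda>y. f y * k y - f y * (k y - l y))"
    by (rule Bochner_Integration.integrable_diff[OF fk fkl])
  then have fl: "integrable lborel (\<lambda>y. f y * l y)" by (simp add: algebra_simps)
  then show "integrable lborel (\<lambda>y. f y * (conj_kernel t (x - y) + poisson_mod t y))"
    by (simp add: l_def)
  have c: "integrable lborel (\<lambda>y. \<bar>f y\<bar> * (1 / (t\<^sup>2 + (x - y)\<^sup>2)))"
    by (rule absf.integrable_mult_kernel[OF t, where C = 1 and x = x]) auto
  have "(LBINT u. poisson t f u * truncated_hilbert_kernel \<epsilon> x u) - (LBINT y. f y * l y)
      = (LBINT y. f y * (k y - l y))"
    using fk fl by (simp add: fubini_truncated_hilbert_poisson(2)[OF t e(1)] k_def right_diff_distrib)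
  also have "\<bar>\<dots>\<bar> \<le> (LBINT y. \<bar>f y * (k y - l y)\<bar>)"
    using integral_norm_bound[of lborel "\<lambda>y. f y * (k y - l y)"] by simp
  also have "\<dots> \<le> (LBINT y. (6 + 2 * t) * \<epsilon> * (\<bar>f y\<bar> * (1 / (t\<^sup>2 + (x - y)\<^sup>2))))"
  proof (rule integral_mono)
    show "\<bar>f y * (k y - l y)\<bar> \<le> (6 + 2 * t) * \<epsilon> * (\<bar>f y\<bar> * (1 / (t\<^sup>2 + (x - y)\<^sup>2)))" for y
      using mult_left_mono[OF kl[of y], of "\<bar>f y\<bar>"] by (simp add: abs_mult mult_ac)
    show "integrable lborel (\<lambda>y. (6 + 2 * t) * \<epsilon> * (\<bar>f y\<bar> * (1 / (t\<^sup>2 + (x - y)\<^sup>2))))"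
      by (intro integrable_mult_right c)
  qed (use fkl in simp)
  also have "\<dots> = (6 + 2 * t) * \<epsilon> * (LBINT y. \<bar>f y\<bar> * (1 / (t\<^sup>2 + (x - y)\<^sup>2)))"
    by (rule integral_mult_right_zero)
  finally show "\<bar>(LBINT u. poisson t f u * truncated_hilbert_kernel \<epsilon> x u)
           - (LBINT y. f y * (conj_kernel t (x - y) + poisson_mod t y))\<bar>
      \<le> (6 + 2 * t) * \<epsilon> * (LBINT y. \<bar>f y\<bar> * (1 / (t\<^sup>2 + (x - y)\<^sup>2)))"
    by (simp only: l_def)
qed

lemma has_pv_integral_hilbert_poisson:
  assumes t: "t > 0"
  shows "has_pv_integral (hilbert_integrand (poisson t f) x) x
           (LBINT y. f y * (conj_kernel t (x - y) + poisson_mod t y))"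
proof -
  interpret P: hoelder_function "poisson t f" K \<alpha> by (rule hoelder_function_poisson[OF t])
  have eq: "indicator {y. \<epsilon> < \<bar>x - y\<bar>} u *\<^sub>R hilbert_integrand (poisson t f) x u
      = poisson t f u * truncated_hilbert_kernel \<epsilon> x u" for \<epsilon> u
    by (simp add: hilbert_integrand_def truncated_hilbert_kernel_def)
  have int: "integrable lebesgue (\<lambda>u. poisson t f u * truncated_hilbert_kernel \<epsilon> x u)" if "\<epsilon> > 0" for \<epsilon>
  proof -
    have "integrable lborel (\<lambda>u. poisson t f u * truncated_hilbert_kernel \<epsilon> x u)"
      by (rule P.integrable_mult_kernel[OF _ _ truncated_hilbert_kernel_le[OF that]]) auto
    then show ?thesis by (simp add: integrable_completion)
  qed
  define M where "M = (6 + 2 * t) * (LBINT y. \<bar>f y\<bar> * (1 / (t\<^sup>2 + (x - y)\<^sup>2)))"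
  define L where "L = (LBINT y. f y * (conj_kernel t (x - y) + poisson_mod t y))"
  have "((\<lambda>\<epsilon>. LBINT u. poisson t f u * truncated_hilbert_kernel \<epsilon> x u) \<longlongrightarrow> L) (at_right 0)"
  proof (rule LIM_zero_cancel, rule Lim_null_comparison)
    show "\<forall>\<^sub>F \<epsilon> in at_right 0. norm ((LBINT u. poisson t f u * truncated_hilbert_kernel \<epsilon> x u) - L) \<le> M * \<epsilon>"
      using eventually_at_right_real[OF t]
    proof eventually_elim
      case (elim \<epsilon>)
      then show ?case
        using truncated_hilbert_poisson_approx(2)[OF t, of \<epsilon> x] by (simp add: M_def L_def mult_ac)
    qed
    show "((\<lambda>\<epsilon>. M * \<epsilon>) \<longlongrightarrow> 0) (at_right 0)"
      by (auto intro!: tendsto_eq_intros)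
  qed
  moreover have "(LINT u|lebesgue. poisson t f u * truncated_hilbert_kernel \<epsilon> x u)
      = (LBINT u. poisson t f u * truncated_hilbert_kernel \<epsilon> x u)" for \<epsilon>
    by (simp add: integral_completion)
  ultimately show ?thesis
    using int unfolding has_pv_integral_def set_integrable_def set_lebesgue_integral_def eq
    by (simp add: L_def)
qed

lemma hilbert_poisson_eq:
  assumes "t > 0"
  shows "hilbert (poisson t f) x = 1 / pi * (LBINT y. f y * (conj_kernel t (x - y) + poisson_mod t y))"
proof -
  have "pv_integral (hilbert_integrand (poisson t f) x) x
      = (LBINT y. f y * (conj_kernel t (x - y) + poisson_mod t y))"
    unfolding pv_integral_def
  proof (rule the_equality)
    show "has_pv_integral (hilbert_integrand (poisson t f) x) x
           (LBINT y. f y * (conj_kernel t (x - y) + poisson_mod t y))"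
      by (rule has_pv_integral_hilbert_poisson[OF assms])
    then show "l = (LBINT y. f y * (conj_kernel t (x - y) + poisson_mod t y))"
      if "has_pv_integral (hilbert_integrand (poisson t f) x) x l" for l
      using that unfolding has_pv_integral_def
      by (auto intro: tendsto_unique[rotated])
  qed
  then show ?thesis by (simp add: hilbert_def)
qed

end

section \<open>The derivative of the conjugate function\<close>

definition conj_kernel_deriv :: "real \<Rightarrow> real \<Rightarrow> real" where
  "conj_kernel_deriv t s = (t\<^sup>2 - s\<^sup>2) / (t\<^sup>2 + s\<^sup>2)\<^sup>2"

lemma conj_kernel_deriv_measurable [measurable]: "conj_kernel_deriv t \<in> borel_measurable borel"
  unfolding conj_kernel_deriv_def by measurable

lemma conj_kernel_deriv_le:
  assumes "t > 0"
  shows "\<bar>conj_kernel_deriv t s\<bar> \<le> 1 / (t\<^sup>2 + s\<^sup>2)"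
proof -
  define N where "N = t\<^sup>2 + s\<^sup>2"
  have N: "N > 0" using sum_sq_pos[OF assms] by (simp add: N_def)
  have "\<bar>t\<^sup>2 - s\<^sup>2\<bar> \<le> N" unfolding N_def by (rule abs_leI) auto
  then have "\<bar>t\<^sup>2 - s\<^sup>2\<bar> / N\<^sup>2 \<le> N / N\<^sup>2" by (rule divide_right_mono) simp
  then have "\<bar>(t\<^sup>2 - s\<^sup>2) / N\<^sup>2\<bar> \<le> 1 / N" using N by (simp add: abs_divide power2_eq_square[of N])
  then show ?thesis by (simp only: conj_kernel_deriv_def N_def)
qed

lemma conj_kernel_has_derivative:
  assumes "t > 0"
  shows "(conj_kernel t has_real_derivative conj_kernel_deriv t s) (at s)"
proof -
  have "t\<^sup>2 + s\<^sup>2 > 0" by (rule sum_sq_pos[OF assms])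
  then have "((\<lambda>s. s / (t\<^sup>2 + s\<^sup>2)) has_real_derivative (1 * (t\<^sup>2 + s\<^sup>2) - s * (2 * s)) / ((t\<^sup>2 + s\<^sup>2) * (t\<^sup>2 + s\<^sup>2))) (at s)"
    by (intro DERIV_divide) (auto intro!: derivative_eq_intros)
  moreover have "(1 * (t\<^sup>2 + s\<^sup>2) - s * (2 * s)) / ((t\<^sup>2 + s\<^sup>2) * (t\<^sup>2 + s\<^sup>2)) = conj_kernel_deriv t s"
    by (simp add: conj_kernel_deriv_def power2_eq_square)
  ultimately show ?thesis by (simp add: conj_kernel_def[abs_def])
qed

lemma has_integral_conj_kernel_deriv:
  assumes t: "t > 0"
  shows "has_bochner_integral lborel (conj_kernel_deriv t) 0"
proof -
  have int: "integrable lborel (conj_kernel_deriv t)"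
  proof (rule Bochner_Integration.integrable_bound)
    show "integrable lborel (\<lambda>s. 1 / (t\<^sup>2 + s\<^sup>2))"
      using has_integral_cauchy[OF t] by (simp add: has_bochner_integral_iff)
    show "AE s in lborel. norm (conj_kernel_deriv t s) \<le> norm (1 / (t\<^sup>2 + s\<^sup>2))"
      unfolding real_norm_def by (intro AE_I2 order_trans[OF conj_kernel_deriv_le[OF t] abs_ge_self])
  qed measurable
  have cont: "isCont (conj_kernel_deriv t) s" for s
    using sum_sq_pos[OF t, of s] unfolding conj_kernel_deriv_def
    by (intro continuous_intros) auto
  have "(conj_kernel t \<longlongrightarrow> 0) at_bot" "(conj_kernel t \<longlongrightarrow> 0) at_top"
    unfolding conj_kernel_def[abs_def] using t by real_asymp+
  then have "(LBINT s. conj_kernel_deriv t s) = 0 - 0"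
    by (intro integral_FTC_line[OF conj_kernel_has_derivative[OF t] cont int])
  then show ?thesis using int by (simp add: has_bochner_integral_iff)
qed

text \<open>Taylor's formula with a remainder that decays in \<open>b\<close> as fast as the derivative itself, for all \<open>h\<close>.
  Integrated against \<open>f\<close> it gives the derivative of the Hilbert transform without a limit theorem.\<close>

lemma conj_kernel_taylor:
  assumes t: "t > 0"
  shows "\<bar>conj_kernel t (b + h) - conj_kernel t b - h * conj_kernel_deriv t b\<bar> \<le> 2 / t * h\<^sup>2 * (1 / (t\<^sup>2 + b\<^sup>2))"
proof -
  define a where "a = b + h"
  define A B where "A = t\<^sup>2 + a\<^sup>2" and "B = t\<^sup>2 + b\<^sup>2"
  have AB: "A > 0" "B > 0" using sum_sq_pos[OF t] by (auto simp: A_def B_def)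
  have h: "h = a - b" by (simp add: a_def)
  have "conj_kernel t a - conj_kernel t b - h * conj_kernel_deriv t b
      = (a * B\<^sup>2 - b * A * B - h * (t\<^sup>2 - b\<^sup>2) * A) / (A * B\<^sup>2)"
    using AB unfolding conj_kernel_def conj_kernel_deriv_def A_def[symmetric] B_def[symmetric]
    by (simp add: field_simps power2_eq_square)
  \<comment> \<open>The numerator vanishes to second order at \<open>h = 0\<close>, and the factor \<open>h\<^sup>2\<close> can be split off exactly.\<close>
  also have "a * B\<^sup>2 - b * A * B - h * (t\<^sup>2 - b\<^sup>2) * A = h\<^sup>2 * (a * (b\<^sup>2 - t\<^sup>2) - 2 * t\<^sup>2 * b)"
    unfolding A_def B_def h by (simp add: power2_eq_square algebra_simps)
  also have "\<bar>h\<^sup>2 * (a * (b\<^sup>2 - t\<^sup>2) - 2 * t\<^sup>2 * b) / (A * B\<^sup>2)\<bar>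
      = h\<^sup>2 * \<bar>a * (b\<^sup>2 - t\<^sup>2) - 2 * t\<^sup>2 * b\<bar> / (A * B\<^sup>2)"
    using AB by (simp add: abs_divide abs_mult)
  also have "\<dots> \<le> h\<^sup>2 * (2 / t * A * B) / (A * B\<^sup>2)"
  proof (intro divide_right_mono mult_left_mono)
    have "t * \<bar>a\<bar> \<le> A"
    proof -
      have "0 \<le> (t - \<bar>a\<bar>)\<^sup>2" by simp
      then have "2 * (t * \<bar>a\<bar>) \<le> A" by (simp add: A_def power2_diff)
      moreover have "0 \<le> t * \<bar>a\<bar>" using t by simp
      ultimately show ?thesis by linarith
    qed
    moreover have "2 * (t * \<bar>b\<bar>) \<le> B"
    proof -
      have "0 \<le> (t - \<bar>b\<bar>)\<^sup>2" by simp
      then show ?thesis by (simp add: B_def power2_diff)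
    qed
    moreover have "\<bar>b\<^sup>2 - t\<^sup>2\<bar> \<le> B" unfolding B_def by (rule abs_leI) auto
    moreover have "t * t \<le> A" by (simp add: A_def power2_eq_square)
    ultimately have "(t * \<bar>a\<bar>) * \<bar>b\<^sup>2 - t\<^sup>2\<bar> + (t * t) * (2 * (t * \<bar>b\<bar>)) \<le> A * B + A * B"
      using t AB by (intro add_mono mult_mono) auto
    then have "t * (\<bar>a\<bar> * \<bar>b\<^sup>2 - t\<^sup>2\<bar> + 2 * t\<^sup>2 * \<bar>b\<bar>) \<le> 2 * A * B"
      by (simp add: algebra_simps power2_eq_square)
    then have "\<bar>a\<bar> * \<bar>b\<^sup>2 - t\<^sup>2\<bar> + 2 * t\<^sup>2 * \<bar>b\<bar> \<le> 2 / t * A * B"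
      using t by (simp add: field_simps)
    moreover have "\<bar>a * (b\<^sup>2 - t\<^sup>2) - 2 * t\<^sup>2 * b\<bar> \<le> \<bar>a\<bar> * \<bar>b\<^sup>2 - t\<^sup>2\<bar> + 2 * t\<^sup>2 * \<bar>b\<bar>"
      using abs_triangle_ineq4[of "a * (b\<^sup>2 - t\<^sup>2)" "2 * t\<^sup>2 * b"] by (simp add: abs_mult)
    ultimately show "\<bar>a * (b\<^sup>2 - t\<^sup>2) - 2 * t\<^sup>2 * b\<bar> \<le> 2 / t * A * B" by linarith
  qed (use AB in auto)
  also have "\<dots> = 2 / t * h\<^sup>2 * (1 / B)"
    using AB by (simp add: power2_eq_square)
  finally show ?thesis by (simp only: a_def B_def)
qed

context hoelder_function
begin

lemma hilbert_poisson_has_derivative: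
  assumes t: "t > 0"
  shows "(hilbert (poisson t f) has_real_derivative
    1 / pi * (LBINT y. f y * conj_kernel_deriv t (x - y))) (at x)"
proof -
  interpret absf: hoelder_function "\<lambda>x. \<bar>f x\<bar>" K \<alpha> by (rule hoelder_function_abs)
  define H where "H = (\<lambda>x. LBINT y. f y * (conj_kernel t (x - y) + poisson_mod t y))"
  define D where "D = (LBINT y. f y * conj_kernel_deriv t (x - y))"
  define M where "M = 2 / t * (LBINT y. \<bar>f y\<bar> * (1 / (t\<^sup>2 + (x - y)\<^sup>2)))"
  have c: "integrable lborel (\<lambda>y. \<bar>f y\<bar> * (1 / (t\<^sup>2 + (x - y)\<^sup>2)))"
    by (rule absf.integrable_mult_kernel[OF t, where C = 1 and x = x]) auto
  have DI: "integrable lborel (\<lambda>y. f y * conj_kernel_deriv t (x - y))"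
    by (rule integrable_mult_kernel[OF t _ conj_kernel_deriv_le[OF t]]) measurable
  have HI: "integrable lborel (\<lambda>y. f y * (conj_kernel t (x - y) + poisson_mod t y))" for x
    by (rule truncated_hilbert_poisson_approx(1)[OF t t order_refl])
  have remainder: "\<bar>H (x + h) - H x - h * D\<bar> \<le> M * h\<^sup>2" for h
  proof -
    define r where "r = (\<lambda>y. conj_kernel t (x - y + h) - conj_kernel t (x - y) - h * conj_kernel_deriv t (x - y))"
    have eq: "f y * r y = f y * (conj_kernel t (x + h - y) + poisson_mod t y)
        - f y * (conj_kernel t (x - y) + poisson_mod t y) - h * (f y * conj_kernel_deriv t (x - y))" for y
      by (simp add: r_def algebra_simps)
    have rI: "integrable lborel (\<lambda>y. f y * r y)"
      unfolding eq by (intro Bochner_Integration.integrable_diff HI integrable_mult_right DI)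
    have "H (x + h) - H x - h * D = (LBINT y. f y * r y)"
      unfolding eq H_def D_def using HI[of x] HI[of "x + h"] DI by simp
    also have "\<bar>\<dots>\<bar> \<le> (LBINT y. \<bar>f y * r y\<bar>)"
      using integral_norm_bound[of lborel "\<lambda>y. f y * r y"] by simp
    also have "\<dots> \<le> (LBINT y. 2 / t * h\<^sup>2 * (\<bar>f y\<bar> * (1 / (t\<^sup>2 + (x - y)\<^sup>2))))"
    proof (rule integral_mono)
      show "\<bar>f y * r y\<bar> \<le> 2 / t * h\<^sup>2 * (\<bar>f y\<bar> * (1 / (t\<^sup>2 + (x - y)\<^sup>2)))" for y
        using mult_left_mono[OF conj_kernel_taylor[OF t, of "x - y" h], of "\<bar>f y\<bar>"]
        by (simp add: abs_mult r_def mult_ac)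
      show "integrable lborel (\<lambda>y. 2 / t * h\<^sup>2 * (\<bar>f y\<bar> * (1 / (t\<^sup>2 + (x - y)\<^sup>2))))"
        by (intro integrable_mult_right c)
    qed (use rI in simp)
    also have "\<dots> = 2 / t * h\<^sup>2 * (LBINT y. \<bar>f y\<bar> * (1 / (t\<^sup>2 + (x - y)\<^sup>2)))"
      by (rule integral_mult_right_zero)
    finally show ?thesis by (simp add: M_def mult_ac)
  qed
  have "(H has_real_derivative D) (at x)"
    unfolding DERIV_def
  proof (rule LIM_zero_cancel, rule Lim_null_comparison)
    show "\<forall>\<^sub>F h in at 0. norm ((H (x + h) - H x) / h - D) \<le> M * \<bar>h\<bar>"
      unfolding eventually_at_filter
    proof (intro always_eventually allI impI)
      fix h :: real assume "h \<noteq> 0"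
      then have "(H (x + h) - H x) / h - D = (H (x + h) - H x - h * D) / h"
        by (simp add: field_simps)
      then have "\<bar>(H (x + h) - H x) / h - D\<bar> = \<bar>H (x + h) - H x - h * D\<bar> / \<bar>h\<bar>"
        by (simp only: abs_divide)
      also have "\<dots> \<le> M * h\<^sup>2 / \<bar>h\<bar>"
        by (intro divide_right_mono remainder) simp
      also have "\<dots> = M * \<bar>h\<bar>"
        using \<open>h \<noteq> 0\<close> by (cases "h > 0") (simp_all add: power2_eq_square)
      finally show "norm ((H (x + h) - H x) / h - D) \<le> M * \<bar>h\<bar>" by simp
    qed
    show "((\<lambda>h. M * \<bar>h\<bar>) \<longlongrightarrow> 0) (at 0)"
      by (auto intro!: tendsto_eq_intros)
  qed
  then have "((\<lambda>x. 1 / pi * H x) has_real_derivative 1 / pi * D) (at x)"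
    by (rule DERIV_cmult)
  moreover have "hilbert (poisson t f) = (\<lambda>x. 1 / pi * H x)"
    using hilbert_poisson_eq[OF t] by (simp add: H_def fun_eq_iff)
  ultimately show ?thesis by (simp add: D_def)
qed

lemma deriv_hilbert_poisson:
  assumes "t > 0"
  shows "deriv (hilbert (poisson t f)) = (\<lambda>x. 1 / pi * (LBINT y. f y * conj_kernel_deriv t (x - y)))"
  using hilbert_poisson_has_derivative[OF assms] by (intro ext DERIV_imp_deriv)

lemma deriv_hilbert_poisson_le:
  assumes t: "t > 0"
  shows "\<bar>deriv (hilbert (poisson t f)) x\<bar> \<le> K * t powr (\<alpha> - 1) / cos (pi * \<alpha> / 2)"
proof -
  define k where "k = (\<lambda>y. conj_kernel_deriv t (x - y))"
  have k: "has_bochner_integral lborel k 0"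
    unfolding k_def by (rule has_integral_reflect_translate[OF has_integral_conj_kernel_deriv[OF t]])
  have "\<bar>(LBINT y. f y * k y) - f x * (LBINT y. k y)\<bar> \<le> K * (pi * t powr (\<alpha> - 1) / cos (pi * \<alpha> / 2))"
  proof (rule abs_integral_minus_mean_le[OF t])
    show "\<bar>k y\<bar> \<le> 1 / (t\<^sup>2 + (x - y)\<^sup>2)" for y
      unfolding k_def by (rule conj_kernel_deriv_le[OF t])
  qed (use k in \<open>auto simp: k_def has_bochner_integral_iff\<close>)
  then have "\<bar>LBINT y. f y * k y\<bar> \<le> pi * (K * t powr (\<alpha> - 1) / cos (pi * \<alpha> / 2))"
    using k by (simp add: has_bochner_integral_iff mult_ac)
  then have "\<bar>LBINT y. f y * k y\<bar> / pi \<le> K * t powr (\<alpha> - 1) / cos (pi * \<alpha> / 2)"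
    by (subst pos_divide_le_eq) (auto simp: mult_ac)
  then show ?thesis by (simp add: deriv_hilbert_poisson[OF t] k_def abs_divide)
qed

end

section \<open>The choice of \<open>t\<close>\<close>

theorem theorem2p3:
  fixes \<omega> \<Omega> :: "real \<Rightarrow> real" and \<alpha> K\<^sub>0 \<sigma>' t :: real
  assumes "\<And>x. \<omega> x > 0"
    and "\<omega> \<in> borel_measurable lebesgue"
    and "Linf_norm \<omega> < \<infinity>"
    and "log_integral \<omega> > -\<infinity>"
    and "0 < \<alpha>" and "\<alpha> < 1" and "K\<^sub>0 > 0"
    and "\<And>x y. \<bar>ln (\<omega> x) - ln (\<omega> y)\<bar> \<le> K\<^sub>0 * \<bar>x - y\<bar> powr \<alpha>"
    and "\<Omega> = (\<lambda>x. - ln (\<omega> x))"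
    and "\<sigma>' > 0"
    and "t = (K\<^sub>0 / (pi * \<sigma>' * cos (pi * \<alpha> / 2))) powr (1 / (1 - \<alpha>))"
  shows "L1_weighted \<Omega> \<and>
    (\<forall>x. \<bar>poisson t \<Omega> x - \<Omega> x\<bar>
        \<le> (K\<^sub>0 / cos (pi * \<alpha> / 2)) powr (1 / (1 - \<alpha>)) * (1 / (pi * \<sigma>')) powr (\<alpha> / (1 - \<alpha>))) \<and>
    L1_weighted (poisson t \<Omega>) \<and>
    (\<forall>x. \<exists>l. has_pv_integral (hilbert_integrand (poisson t \<Omega>) x) x l) \<and>
    (\<forall>x. hilbert (poisson t \<Omega>) differentiable (at x)) \<and>
    Linf_norm (deriv (hilbert (poisson t \<Omega>))) \<le> ereal (pi * \<sigma>')"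
proof -
  interpret hoelder_function \<Omega> K\<^sub>0 \<alpha>
    using assms(5,6,8) by unfold_locales (auto simp: assms(9) abs_minus_commute)
  define c where "c = cos (pi * \<alpha> / 2)"
  define a b where "a = K\<^sub>0 / c" and "b = pi * \<sigma>'"
  have c: "c > 0" using cos_half_pi_\<alpha>_pos by (simp add: c_def)
  have ab: "a > 0" "b > 0" using assms(7,10) c by (auto simp: a_def b_def)
  have t_eq: "t = (a / b) powr (1 / (1 - \<alpha>))"
    by (simp add: assms(11) a_def b_def c_def mult_ac)
  have t: "t > 0" using ab by (simp add: t_eq)
  have t_powr: "t powr e = (a / b) powr (e / (1 - \<alpha>))" for e
    by (simp add: t_eq powr_powr)
  \<comment> \<open>The given \<open>t\<close> satisfies \<open>t\<^bsup>1 - \<alpha>\<^esup> = a / b\<close>, which evaluates both bounds.\<close>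
  have bound1: "K\<^sub>0 * t powr \<alpha> / c = a powr (1 / (1 - \<alpha>)) * (1 / b) powr (\<alpha> / (1 - \<alpha>))"
  proof -
    have "1 + \<alpha> / (1 - \<alpha>) = 1 / (1 - \<alpha>)" using assms(6) by (simp add: field_simps)
    then have "a * a powr (\<alpha> / (1 - \<alpha>)) = a powr (1 / (1 - \<alpha>))"
      using ab by (simp add: powr_mult_base)
    then show ?thesis using ab unfolding t_powr
      by (simp add: a_def[symmetric] powr_divide mult.assoc[symmetric]) (simp add: a_def field_simps)
  qed
  have bound2: "K\<^sub>0 * t powr (\<alpha> - 1) / c = b"
  proof -
    have "(\<alpha> - 1) / (1 - \<alpha>) = - 1" using assms(6) by (simp add: field_simps)
    then have "t powr (\<alpha> - 1) = b / a" using ab by (simp add: t_powr powr_minus)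
    then show ?thesis using assms(7) c by (simp add: a_def)
  qed
  have "L1_weighted (poisson t \<Omega>)"
    by (rule hoelder_function.L1_weighted_f[OF hoelder_function_poisson[OF t]])
  moreover have "\<bar>poisson t \<Omega> x - \<Omega> x\<bar>
      \<le> (K\<^sub>0 / cos (pi * \<alpha> / 2)) powr (1 / (1 - \<alpha>)) * (1 / (pi * \<sigma>')) powr (\<alpha> / (1 - \<alpha>))" for x
    using poisson_approx[OF t, of x] bound1 by (simp add: a_def b_def c_def)
  moreover have "hilbert (poisson t \<Omega>) differentiable (at x)" for x
    using hilbert_poisson_has_derivative[OF t] real_differentiable_def by blast
  moreover have "Linf_norm (deriv (hilbert (poisson t \<Omega>))) \<le> ereal (pi * \<sigma>')"
    unfolding Linf_norm_def
  proof (rule esssup_I)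
    show "(\<lambda>x. ereal \<bar>deriv (hilbert (poisson t \<Omega>)) x\<bar>) \<in> borel_measurable lebesgue"
      unfolding deriv_hilbert_poisson[OF t] by (rule measurable_completion) measurable
    show "AE x in lebesgue. ereal \<bar>deriv (hilbert (poisson t \<Omega>)) x\<bar> \<le> ereal (pi * \<sigma>')"
      using deriv_hilbert_poisson_le[OF t] bound2 by (simp add: b_def c_def)
  qed
  ultimately show ?thesis
    using L1_weighted_f has_pv_integral_hilbert_poisson[OF t] by blast
qed

end
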